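(* For an $n$-cover $\mathcal{F}$, let $\rho\colon H^{\mathrm{int}}_{\mathcal{F}}\to\mathcal{P}$ be a monotone map into a poset $\mathcal{P}$ such that $\rho(s)\neq\rho(-s)$ for all $s\in H^{\mathrm{int}}_{\mathcal{F}}$. Then there is $u\in\mathbb{S}^n$ such that $\rho(s(u))\in \mathcal{P}$ has rank at least $(n+1)/2$. Furthermore, if $\mathcal{P}=\mathcal{H}_{2,\infty}$, then there is $u\in\mathbb{S}^n$ such that the rank of $\rho(s(u))\in\mathcal{P}$ is at least $n$.
   Context: $\mathbb{S}^n$ is the $n$-dimensional sphere, with antipodal map $u\mapsto -u$; for $F\subseteq\mathbb{S}^n$, $-F=\{-u: u\in F\}$. A set $F$ is antipodal-free if $F\cap(-F)=\emptyset$. An $n$-cover is a finite family $\mathcal{F}$ of closed antipodal-free subsets of $\mathbb{S}^n$ whose union is $\mathbb{S}^n$. Samples: a sample over $\mathcal{F}$ is a function $s\colon\mathcal{F}\to\{-1,1,*\}$, where $*$ is treated as "undefined". Samples are partially ordered by extension: $s_1\leq s_2$ if $s_1(F)=s_2(F)$ for every $F\in\mathcal{F}$ with $s_1(F)\neq *$. The empty sample is the one identically equal to $*$. $\mathcal{S}_{\mathcal{F}}$ denotes the poset of all nonempty samples over $\mathcal{F}$. The antipode $-s$ of $s$ is obtained by flipping signs: $(-s)(F)=-s(F)$ if $s(F)\in\{\pm1\}$, and $(-s)(F)=*$ if $s(F)=*$. For $u\in\mathbb{S}^n$, the sample $s(u)\in\mathcal{S}_{\mathcal{F}}$ is defined by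 $s(u)(F)=1$ if $u\in F$, $s(u)(F)=-1$ if $u\in -F$, and $s(u)(F)=*$ otherwise (this is well defined since each $F$ is antipodal-free, and nonempty since $\mathcal{F}$ is a cover). Put $H^{\mathrm{ex}}_{\mathcal{F}}=\{s(u): u\in\mathbb{S}^n\}$ and $$H^{\mathrm{int}}_{\mathcal{F}}=\{s\in\mathcal{S}_{\mathcal{F}} : \text{there are } s',s''\in H^{\mathrm{ex}}_{\mathcal{F}}\text{ with } s'\leq s\leq s''\},$$ with the order induced from $\mathcal{S}_{\mathcal{F}}$. Both sets are closed under $s\mapsto -s$, and $H^{\mathrm{ex}}_{\mathcal{F}}\subseteq H^{\mathrm{int}}_{\mathcal{F}}$. A map between posets is monotone if it is order-preserving. The rank of an element $p$ of a poset $\mathcal{P}$ is the maximal length of a strictly increasing chain in $\mathcal{P}$ ending at $p$, where the length of a chain is the number of its elements minus one. $\mathcal{H}_{2,\infty}$ is the poset with elements $[k]$ and $[-k]$ for all integers $k\geq2$, where $[\pm k]<[\pm l]$ for every choice of signs whenever $k<l$, and $[k]$ and $[-k]$ are incomparable. Thus $[\pm m]$ has rank $m-2$.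
   Formalization: The first assertion is stated for n ≥ 1 only; for n = 0 it fails, since H^int for the cover {{1},{-1}} of the 0-sphere has two incomparable elements, which map injectively into a two-element antichain with all ranks 0 < 1/2. *)

theory Defs
  imports "HOL-Analysis.Analysis"
begin

text \<open>
  The sphere \<open>S\<^sup>n\<close> is \<open>sphere 0 1\<close> in a Euclidean space of dimension \<open>n + 1\<close>.
\<close>

definition antipodal_free :: "'a::euclidean_space set \<Rightarrow> bool" where
  "antipodal_free A \<longleftrightarrow> A \<inter> uminus ` A = {}"

definition sphere_cover :: "nat \<Rightarrow> 'a::euclidean_space set set \<Rightarrow> bool" where
  "sphere_cover n \<F> \<longleftrightarrow>
     DIM('a) = n + 1 \<and> finite \<F> \<and>
     (\<forall>A\<in>\<F>. closedin (top_of_set (sphere 0 1)) A \<and> antipodal_free A) \<and>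
     \<Union>\<F> = sphere 0 1"

text \<open>
  A sample over \<open>\<F>\<close> is a partial map with domain contained in \<open>\<F>\<close> and values in \<open>{-1, 1}\<close>;
  the undefined value \<open>*\<close> is \<open>None\<close>. Extension of samples is \<open>\<subseteq>\<^sub>m\<close>.
\<close>

type_synonym 'a sample = "'a set \<rightharpoonup> int"

definition samples :: "'a set set \<Rightarrow> 'a sample set" where
  "samples \<F> = {s. dom s \<subseteq> \<F> \<and> ran s \<subseteq> {-1, 1} \<and> s \<noteq> Map.empty}"

definition antipode :: "'a sample \<Rightarrow> 'a sample" where
  "antipode s = (\<lambda>A. map_option uminus (s A))"

definition point_sample :: "'a::euclidean_space set set \<Rightarrow> 'a \<Rightarrow> 'a sample" where
  "point_sample \<F> u = (\<lambda>A.
     if A \<in> \<F> \<and> u \<in> A then Some 1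
     else if A \<in> \<F> \<and> u \<in> uminus ` A then Some (-1)
     else None)"

definition H_ex :: "'a::euclidean_space set set \<Rightarrow> 'a sample set" where
  "H_ex \<F> = point_sample \<F> ` sphere 0 1"

definition H_int :: "'a::euclidean_space set set \<Rightarrow> 'a sample set" where
  "H_int \<F> = {s \<in> samples \<F>. \<exists>s'\<in>H_ex \<F>. \<exists>s''\<in>H_ex \<F>. s' \<subseteq>\<^sub>m s \<and> s \<subseteq>\<^sub>m s''}"

text \<open>
  The rank is \<open>\<infinity>\<close> if the strictly increasing chains ending at \<open>p\<close> have unbounded length.
\<close>

definition poset_rank :: "'p::order \<Rightarrow> enat" where
  "poset_rank p =
     Sup {enat (length xs - 1) | xs. xs \<noteq> [] \<and> sorted_wrt (<) xs \<and> last xs = p}"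

text \<open>
  The poset \<open>\<H>\<^bsub>2,\<infinity>\<^esub>\<close>: the element \<open>[m]\<close> is represented by the integer \<open>m\<close> with \<open>\<bar>m\<bar> \<ge> 2\<close>.
\<close>

typedef H2inf = "{m::int. 2 \<le> \<bar>m\<bar>}"
  by (rule exI[of _ 2]) simp

instantiation H2inf :: order
begin

definition less_eq_H2inf :: "H2inf \<Rightarrow> H2inf \<Rightarrow> bool" where
  "p \<le> q \<longleftrightarrow> p = q \<or> \<bar>Rep_H2inf p\<bar> < \<bar>Rep_H2inf q\<bar>"

definition less_H2inf :: "H2inf \<Rightarrow> H2inf \<Rightarrow> bool" where
  "p < q \<longleftrightarrow> \<bar>Rep_H2inf p\<bar> < \<bar>Rep_H2inf q\<bar>"

instance
  by standard (auto simp: less_eq_H2inf_def less_H2inf_def)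

end

end

theory Submission
  imports Defs "HOL-Library.Z2"
begin

text \<open>
  Extend the sample of a point to small subsets \<open>e\<close> of the sphere, with value \<open>1\<close> at the members that
  \<open>e\<close> meets. For small \<open>e\<close> this lies in \<open>H_int\<close>, so \<open>\<rho>\<close> yields a monotone map \<open>r\<close> on the poset of small
  sets with \<open>r (- e) \<noteq> r e\<close>. Up to a change of scale, the mod 2 cochains of this poset compute the
  reduced cohomology of the sphere, which vanishes below degree \<open>n\<close>. It follows that for every
  labelling of small sets by two signs with opposite signs at \<open>e\<close> and \<open>- e\<close>, the cochain counting
  chains of \<open>m + 1\<close> sets whose signs alternate and start with \<open>+\<close> is not a coboundary if \<open>m \<le> n\<close>.

  For \<open>\<H>\<^bsub>2,\<infinity>\<^esub>\<close>, the smaller in absolute value of \<open>r e\<close> and \<open>- r (- e)\<close> is monotone and odd in \<open>e\<close>. If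
  only \<open>n\<close> levels occur, no chain of \<open>n + 1\<close> sets alternates for its sign, a contradiction for \<open>m = n\<close>.

  For general \<open>\<P>\<close>, suppose that all ranks are at most \<open>d = \<lfloor>n / 2\<rfloor>\<close> and label \<open>e\<close> by an antisymmetric
  function of \<open>(r e, r (- e))\<close>. An alternating chain of \<open>2 d + 1\<close> sets maps to a maximal staircase in
  a product of two posets of rank \<open>d\<close>. The indicators of the staircases with the same sides are
  cohomologous, and that of one of them is a cup product whose first factor is a cocycle of degree
  \<open>d < n\<close>, hence a coboundary: a contradiction for \<open>m = 2 d\<close>.
\<close>

declare add_bit_eq_xor [simp del] mult_bit_eq_and [simp del]

lemma bit_add_self [simp]: "x + x = (0::bit)"
  by (cases x) simp_all

lemma bit_add_self_left [simp]: "x + (x + y) = (y::bit)"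
  by (simp flip: add.assoc)

lemma bit_add_eq_0_iff: "x + y = 0 \<longleftrightarrow> x = (y::bit)"
  by (cases x; cases y) simp_all

lemma bit_add_eq_iff: "x + y = z \<longleftrightarrow> x = y + (z::bit)"
  by (cases x; cases y; cases z) simp_all

lemma bit_add_trans: "x + y = p \<Longrightarrow> y + z = q \<Longrightarrow> x + z = p + (q::bit)"
  by (cases x; cases y; cases z) auto

subsection \<open>Cochains modulo 2 on the multichains of a poset\<close>

text \<open>The simplicial coboundary modulo 2, with \<open>[]\<close> as a simplex of degree -1.
  Peeling off the head, with \<open>a\<close> generalized, turns the cochain identities below into
  inductions over the list.\<close>

primrec cobd :: "('p list \<Rightarrow> bit) \<Rightarrow> 'p list \<Rightarrow> bit" where
  "cobd a [] = 0"
| "cobd a (x # xs) = a xs + cobd (\<lambda>ys. a (x # ys)) xs"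

text \<open>Repetitions are allowed so that monotone maps, which may identify elements, act on these
  lists.\<close>

definition multichains :: "'p::order set \<Rightarrow> nat \<Rightarrow> 'p list set" where
  "multichains X l = {xs. length xs = l \<and> set xs \<subseteq> X \<and> sorted_wrt (\<le>) xs}"

lemma multichains_mono: "X \<subseteq> Y \<Longrightarrow> multichains X l \<subseteq> multichains Y l"
  by (auto simp: multichains_def)

lemma multichains_0 [simp]: "multichains X 0 = {[]}"
  by (auto simp: multichains_def)

lemma multichains_map:
  assumes "xs \<in> multichains X l" "\<And>x. x \<in> X \<Longrightarrow> f x \<in> Y" "monotone_on X (\<le>) (\<le>) f"
  shows "map f xs \<in> multichains Y l"
proof -
  have "sorted_wrt (\<lambda>x y. f x \<le> f y) xs"
    by (rule sorted_wrt_mono_rel[of xs "(\<le>)"]) (use assms in \<open>auto simp: multichains_def monotone_on_def\<close>)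
  then show ?thesis
    using assms(1,2) by (auto simp: multichains_def sorted_wrt_map)
qed

lemma cobd_eq_sum:
  "cobd a xs = (\<Sum>i<length xs. a (take i xs @ drop (Suc i) xs))"
  by (induction xs arbitrary: a) (simp_all add: sum.lessThan_Suc_shift del: sum.lessThan_Suc)

lemma multichains_face:
  assumes "xs \<in> multichains X (Suc l)" "i < Suc l"
  shows "take i xs @ drop (Suc i) xs \<in> multichains X l"
proof -
  have "xs = take i xs @ xs ! i # drop (Suc i) xs"
    using assms by (simp add: multichains_def id_take_nth_drop)
  then have "sorted_wrt (\<le>) (take i xs @ xs ! i # drop (Suc i) xs)"
    "set (take i xs @ drop (Suc i) xs) \<subseteq> X"
    using assms by (auto simp: multichains_def dest: in_set_takeD in_set_dropD)
  then show ?thesis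
    using assms by (auto simp: multichains_def sorted_wrt_append)
qed

lemma cobd_cong_faces:
  assumes "\<And>i. i < length xs \<Longrightarrow>
             a (take i xs @ drop (Suc i) xs) = b (take i xs @ drop (Suc i) xs)"
  shows "cobd a xs = cobd b xs"
  using assms by (simp add: cobd_eq_sum)

lemma cobd_0 [simp]: "cobd (\<lambda>_. 0) xs = 0"
  by (simp add: cobd_eq_sum)

lemma cobd_add: "cobd (\<lambda>ys. a ys + b ys) xs = cobd a xs + cobd b xs"
  by (simp add: cobd_eq_sum sum.distrib)

lemma cobd_mult_left: "cobd (\<lambda>ys. c * a ys) xs = c * cobd a xs"
  by (simp add: cobd_eq_sum sum_distrib_left)

lemma cobd_sum: "cobd (\<lambda>ys. \<Sum>i\<in>I. a i ys) xs = (\<Sum>i\<in>I. cobd (a i) xs)"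
  by (simp add: cobd_eq_sum sum.swap[of _ I])

lemma cobd_map: "cobd (\<lambda>ys. a (map f ys)) xs = cobd a (map f xs)"
  by (simp add: cobd_eq_sum take_map drop_map)

lemma cobd_cobd [simp]: "cobd (cobd a) xs = 0"
  by (induction xs arbitrary: a) (simp_all add: cobd_add)

lemma cobd_snoc: "cobd a (xs @ [m]) = cobd (\<lambda>ys. a (ys @ [m])) xs + a xs"
  by (induction xs arbitrary: a) (simp_all add: add.assoc)

text \<open>Omitting either of the two equal neighbours leaves the same list, so these terms cancel;
  every other face still contains the repetition.\<close>

lemma cobd_normalized:
  assumes "\<And>u x v. a (u @ x # x # v) = 0"
  shows "cobd a (u @ x # x # v) = 0"
  using assms
proof (induction u arbitrary: a)
  case Nil
  then have "cobd (\<lambda>ys. a (x # x # ys)) v = cobd (\<lambda>_. 0) v"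
    by (metis append_Nil)
  then show ?case by simp
next
  case (Cons y u)
  have "cobd (\<lambda>ys. a (y # ys)) (u @ x # x # v) = 0"
    by (rule Cons.IH) (use Cons.prems[of "y # _"] in simp)
  then show ?case using Cons.prems by simp
qed

subsection \<open>Homotopies\<close>

text \<open>The usual prism on \<open>f \<le> g\<close>: \<open>\<Sum>\<^sub>i a [f x\<^sub>0, \<dots>, f x\<^sub>i, g x\<^sub>i, \<dots>]\<close>.\<close>

primrec prism :: "('p \<Rightarrow> 'q) \<Rightarrow> ('p \<Rightarrow> 'q) \<Rightarrow> ('q list \<Rightarrow> bit) \<Rightarrow> 'p list \<Rightarrow> bit" where
  "prism f g a [] = 0"
| "prism f g a (x # xs) = a (f x # g x # map g xs) + prism f g (\<lambda>ys. a (f x # ys)) xs"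

lemma prism_add: "prism f g (\<lambda>ys. a ys + b ys) xs = prism f g a xs + prism f g b xs"
  by (induction xs arbitrary: a b) (simp_all add: algebra_simps)

text \<open>The chain homotopy formula, free of signs modulo 2. It is a formal identity on lists;
  the order enters later, when the lists fed to \<open>a\<close> have to be multichains.\<close>

lemma cobd_prism:
  "cobd (prism f g a) xs + prism f g (cobd a) xs = a (map f xs) + a (map g xs)"
proof (induction xs arbitrary: a)
  case (Cons x xs)
  define b where "b = (\<lambda>ys. a (f x # ys))"
  define c where "c = cobd (\<lambda>ys. a (f x # g x # ys)) (map g xs)"
  have p: "prism f g a (x # ys) = b (g x # map g ys) + prism f g b ys" for ys
    by (simp add: b_def)
  have "cobd (prism f g a) (x # xs) = prism f g a xs + (c + cobd (prism f g b) xs)"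
    unfolding cobd.simps p cobd_add c_def b_def by (simp flip: cobd_map)
  moreover have "(\<lambda>ys. cobd a (f x # ys)) = (\<lambda>ys. a ys + cobd b ys)"
    by (simp add: b_def)
  then have "prism f g (cobd a) (x # xs) =
      a (g x # map g xs) + (b (map g xs) + c) + (prism f g a xs + prism f g (cobd b) xs)"
    by (simp add: prism_add b_def c_def)
  ultimately have "cobd (prism f g a) (x # xs) + prism f g (cobd a) (x # xs) =
      (prism f g a xs + prism f g a xs) + (c + c) + a (g x # map g xs) + b (map g xs) +
      (cobd (prism f g b) xs + prism f g (cobd b) xs)"
    by (simp only: ac_simps)
  also have "\<dots> = a (map f (x # xs)) + a (map g (x # xs)) + (b (map g xs) + b (map g xs))"
    unfolding Cons.IH bit_add_self by (simp add: b_def ac_simps)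
  finally show ?case by simp
qed simp

text \<open>In the induction \<open>f x\<close> moves into the cochain, which may then be evaluated
  only at lists lying above \<open>f x\<close>; the lower bound in the last assumption keeps track
  of this.\<close>

lemma prism_eq_0:
  assumes "xs \<in> multichains X l" "monotone_on X (\<le>) (\<le>) f" "monotone_on X (\<le>) (\<le>) g"
    and "\<And>x. x \<in> X \<Longrightarrow> f x \<in> Y \<and> g x \<in> Y \<and> f x \<le> g x"
    and "\<And>zs. zs \<in> multichains Y (Suc l) \<Longrightarrow> \<forall>z\<in>set zs. \<exists>x\<in>set xs. f x \<le> z \<Longrightarrow> a zs = 0"
  shows "prism f g a xs = 0"
  using assms(1,5)
proof (induction xs arbitrary: a l)
  case (Cons x xs)
  then obtain k where k: "l = Suc k" "xs \<in> multichains X k" "x \<in> X" "\<forall>y\<in>set xs. x \<le> y" "set xs \<subseteq> X"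
    by (auto simp: multichains_def)
  have m: "map g (x # xs) \<in> multichains Y l"
    by (rule multichains_map[OF Cons.prems(1)]) (use assms in auto)
  have fx: "f x \<le> f y" if "y \<in> set xs" for y
    using that k assms(2) by (auto simp: monotone_on_def)
  have fg: "f y \<in> Y \<and> g y \<in> Y \<and> f y \<le> g y" if "y \<in> set (x # xs)" for y
    using that k assms(4) by auto
  have "a (f x # map g (x # xs)) = 0"
  proof (rule Cons.prems)
    show "f x # map g (x # xs) \<in> multichains Y (Suc l)"
    proof -
      have "f x \<le> z" if "z \<in> set (map g (x # xs))" for z
        using that fx fg by (auto intro: order_trans)
      then show ?thesis
        using m fg by (auto simp: multichains_def)
    qed
    show "\<forall>z\<in>set (f x # map g (x # xs)). \<exists>x\<in>set (x # xs). f x \<le> z"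
      using fg by auto
  qed
  moreover have "prism f g (\<lambda>ys. a (f x # ys)) xs = 0"
  proof (rule Cons.IH[OF k(2)], rule Cons.prems)
    fix zs assume zs: "zs \<in> multichains Y (Suc k)" "\<forall>z\<in>set zs. \<exists>x\<in>set xs. f x \<le> z"
    then have "\<forall>z\<in>set zs. f x \<le> z" using fx by (meson order_trans)
    then show "f x # zs \<in> multichains Y (Suc l)"
      using zs k fg by (auto simp: multichains_def)
    show "\<forall>z\<in>set (f x # zs). \<exists>x\<in>set (x # xs). f x \<le> z"
      using zs by auto
  qed
  ultimately show ?case by simp
qed simp

lemma prism_homotopy:
  assumes "xs \<in> multichains X l" "monotone_on X (\<le>) (\<le>) f" "monotone_on X (\<le>) (\<le>) g"
    and "\<And>x. x \<in> X \<Longrightarrow> f x \<in> Y \<and> g x \<in> Y \<and> f x \<le> g x"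
    and "\<And>zs. zs \<in> multichains Y (Suc l) \<Longrightarrow> cobd a zs = 0"
  shows "a (map f xs) + a (map g xs) = cobd (prism f g a) xs"
proof -
  have "prism f g (cobd a) xs = 0"
    by (rule prism_eq_0[OF assms(1-4)]) (use assms(5) in auto)
  then show ?thesis using cobd_prism[of f g a xs] by simp
qed

subsection \<open>Cup products\<close>

text \<open>Here \<open>a\<close> lives on lists of length \<open>k \<ge> 1\<close>; the two factors share one vertex.\<close>

definition cup :: "nat \<Rightarrow> ('p list \<Rightarrow> bit) \<Rightarrow> ('p list \<Rightarrow> bit) \<Rightarrow> 'p list \<Rightarrow> bit" where
  "cup k a b xs = a (take k xs) * b (drop (k - 1) xs)"

text \<open>The Leibniz rule. On the right, omitting the last vertex in the first factor and the
  first vertex in the second both give \<open>a (take (k + 1) xs) * b (drop (k + 1) xs)\<close>,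
  which cancels.\<close>

lemma cobd_cup:
  assumes "length xs \<ge> k + 2"
  shows "cobd (cup (Suc k) a b) xs =
           cobd a (take (k + 2) xs) * b (drop (k + 1) xs) +
           a (take (k + 1) xs) * cobd b (drop k xs)"
  using assms
proof (induction k arbitrary: a xs)
  case 0
  then obtain x y zs where xs: "xs = x # y # zs"
    by (auto simp: numeral_2_eq_2 Suc_le_length_iff)
  have "(\<lambda>ys. cup (Suc 0) a b (x # ys)) = (\<lambda>ys. a [x] * b (x # ys))"
    by (simp add: cup_def)
  then have "cobd (cup (Suc 0) a b) xs = a [y] * b (y # zs) + a [x] * cobd (\<lambda>ys. b (x # ys)) (y # zs)"
    by (simp only: cobd.simps xs cobd_mult_left) (simp add: cup_def)
  then show ?case
    by (simp add: xs algebra_simps)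
next
  case (Suc k)
  then obtain x ys where xs: "xs = x # ys" "length ys \<ge> k + 2"
    by (cases xs) auto
  have "(\<lambda>ys. cup (Suc (Suc k)) a b (x # ys)) = cup (Suc k) (\<lambda>ys. a (x # ys)) b"
    by (simp add: cup_def fun_eq_iff)
  then have "cobd (cup (Suc (Suc k)) a b) xs =
      cup (Suc (Suc k)) a b ys + cobd (cup (Suc k) (\<lambda>ys. a (x # ys)) b) ys"
    by (simp add: xs)
  also have "\<dots> = a (take (k + 2) ys) * b (drop (k + 1) ys) +
      (cobd (\<lambda>ys. a (x # ys)) (take (k + 2) ys) * b (drop (k + 1) ys) +
       a (x # take (k + 1) ys) * cobd b (drop k ys))"
    by (subst Suc.IH) (use xs in \<open>simp_all add: cup_def\<close>)
  finally show ?case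
    by (simp add: xs algebra_simps)
qed

subsection \<open>Alternating multichains\<close>

fun alternating :: "('p \<Rightarrow> bool) \<Rightarrow> bool \<Rightarrow> 'p list \<Rightarrow> bool" where
  "alternating h s [] = True"
| "alternating h s (x # xs) = (h x = s \<and> alternating h (\<not> s) xs)"

text \<open>A nonempty list alternating from either sign has exactly one face alternating from
  \<open>s\<close>, obtained by omitting an end. Any other list with such a face has one adjacent
  pair of equal signs, and the two ways of breaking this pair cancel.\<close>

lemma cobd_alternating:
  "cobd (\<lambda>ys. of_bool (alternating h s ys)) xs =
     of_bool (alternating h s xs) + of_bool (alternating h (\<not> s) xs)"
proof (induction xs arbitrary: s)
  case (Cons x xs)
  have "(\<lambda>ys. of_bool (alternating h s (x # ys))) =
      (\<lambda>ys. of_bool (h x = s) * of_bool (alternating h (\<not> s) ys) :: bit)"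
    by auto
  then show ?case
    using Cons.IH[of "\<not> s"] by (cases "h x = s") (auto simp: cobd_mult_left)
qed simp

lemma alternating_map: "alternating h s (map f xs) = alternating (h \<circ> f) s xs"
  by (induction xs arbitrary: s) auto

lemma alternating_antisymmetric:
  assumes "\<And>x. x \<in> set xs \<Longrightarrow> h (f x) \<longleftrightarrow> \<not> h x"
  shows "alternating h s (map f xs) = alternating h (\<not> s) xs"
  using assms by (induction xs arbitrary: s) auto

text \<open>Neighbours of opposite sign are distinct.\<close>

lemma alternating_strict:
  assumes "alternating h s xs" "sorted_wrt (\<le>) xs"
  shows "sorted_wrt (<) (xs :: 'p::order list)"
proof -
  have "successively (<) xs"
    using assms
  proof (induction xs arbitrary: s)
    case (Cons x xs)
    then show ?case by (cases xs) (auto simp: order_less_le)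
  qed simp
  then show ?thesis by (simp add: successively_conv_sorted_wrt transp_on_less)
qed

subsection \<open>Small subsets of spheres\<close>

definition small :: "'a::metric_space set \<Rightarrow> real \<Rightarrow> 'a set set" where
  "small S r = {e. e \<noteq> {} \<and> e \<subseteq> S \<and> (\<forall>x\<in>e. \<forall>y\<in>e. dist x y \<le> r)}"

lemma small_mono: "S \<subseteq> S' \<Longrightarrow> r \<le> r' \<Longrightarrow> small S r \<subseteq> small S' r'"
  by (force simp: small_def)

lemma smallD: "e \<in> small S r \<Longrightarrow> x \<in> e \<Longrightarrow> y \<in> e \<Longrightarrow> dist x y \<le> r"
  by (simp add: small_def)

lemma small_restrict:
  assumes "e \<in> small S r" "r \<le> r'" "\<And>x. x \<in> e \<Longrightarrow> x \<in> S \<Longrightarrow> x \<in> S'"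
  shows "e \<in> small S' r'"
  using assms by (force simp: small_def)

lemma image_small:
  assumes "e \<in> small S r" "\<And>x. x \<in> S \<Longrightarrow> f x \<in> S'"
    "\<And>x y. x \<in> S \<Longrightarrow> y \<in> S \<Longrightarrow> dist x y \<le> r \<Longrightarrow> dist (f x) (f y) \<le> r'"
  shows "f ` e \<in> small S' r'"
  using assms unfolding small_def by (auto simp: subset_iff)

lemma monotone_on_image: "monotone_on X (\<le>) (\<le>) (image f)"
  by (auto simp: monotone_on_def)

text \<open>The two image maps need not be comparable, but both lie below the union of the two
  images; two prisms meet there.\<close>

lemma image_homotopy:
  assumes S': "\<And>x. x \<in> S \<Longrightarrow> f x \<in> S' \<and> g x \<in> S'"
    and d: "\<And>x y. x \<in> S \<Longrightarrow> y \<in> S \<Longrightarrow> dist x y \<le> r \<Longrightarrow>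
              dist (f x) (f y) \<le> r' \<and> dist (f x) (g y) \<le> r' \<and> dist (g x) (g y) \<le> r'"
    and a: "\<And>zs. zs \<in> multichains (small S' r') (Suc l) \<Longrightarrow> cobd a zs = 0"
  shows "\<exists>c. \<forall>xs\<in>multichains (small S r) l.
           a (map (image f) xs) + a (map (image g) xs) = cobd c xs"
proof (intro exI ballI)
  fix xs assume xs: "xs \<in> multichains (small S r) l"
  let ?fg = "\<lambda>e. f ` e \<union> g ` e"
  have fg: "monotone_on (small S r) (\<le>) (\<le>) ?fg"
    by (auto simp: monotone_on_def)
  have m: "f ` e \<in> small S' r'" "g ` e \<in> small S' r'" if "e \<in> small S r" for e
    by (rule image_small[OF that]; use S' d in blast)+
  have m': "?fg e \<in> small S' r'" if e: "e \<in> small S r" for e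
  proof -
    have "dist (f x) (g y) \<le> r'" "dist (g y) (f x) \<le> r'" if "x \<in> e" "y \<in> e" for x y
      using d[of x y] e that by (auto simp: small_def dist_commute)
    then show ?thesis
      using m[OF e] by (auto simp: small_def)
  qed
  have 1: "a (map (image f) xs) + a (map ?fg xs) = cobd (prism (image f) ?fg a) xs"
    by (rule prism_homotopy[OF xs monotone_on_image fg _ a]) (use m m' in auto)
  have 2: "a (map (image g) xs) + a (map ?fg xs) = cobd (prism (image g) ?fg a) xs"
    by (rule prism_homotopy[OF xs monotone_on_image fg _ a]) (use m m' in auto)
  have "cobd (\<lambda>ys. prism (image f) ?fg a ys + prism (image g) ?fg a ys) xs =
      a (map (image f) xs) + a (map (image g) xs) + (a (map ?fg xs) + a (map ?fg xs))"
    by (simp only: cobd_add 1[symmetric] 2[symmetric] ac_simps)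
  then show "a (map (image f) xs) + a (map (image g) xs) =
      cobd (\<lambda>ys. prism (image f) ?fg a ys + prism (image g) ?fg a ys) xs"
    by simp
qed

text \<open>The homotopy is cut into \<open>N\<close> stages so short that
  \<open>image_homotopy\<close> applies to consecutive ones, and the resulting cochains add up. The
  scale \<open>r\<close> is fixed before the cochain.\<close>

lemma lipschitz_homotopy:
  fixes F :: "real \<Rightarrow> 'a::metric_space \<Rightarrow> 'b::metric_space"
  assumes S': "\<And>t x. 0 \<le> t \<Longrightarrow> t \<le> 1 \<Longrightarrow> x \<in> S \<Longrightarrow> F t x \<in> S'"
    and K: "\<And>s t x y. 0 \<le> s \<Longrightarrow> s \<le> 1 \<Longrightarrow> 0 \<le> t \<Longrightarrow> t \<le> 1 \<Longrightarrow> x \<in> S \<Longrightarrow> y \<in> S \<Longrightarrow>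
              dist (F s x) (F t y) \<le> K * (dist x y + \<bar>s - t\<bar>)"
    and "K > 0" "\<delta> > 0"
  shows "\<exists>r>0. \<forall>l a. (\<forall>zs\<in>multichains (small S' \<delta>) (Suc l). cobd a zs = 0) \<longrightarrow>
           (\<exists>c. \<forall>xs\<in>multichains (small S r) l.
              a (map (image (F 0)) xs) + a (map (image (F 1)) xs) = cobd c xs)"
proof -
  \<comment> \<open>Half of \<open>\<delta>\<close> pays for the time step,
    \<open>K * (1 / N)\<close>, the other half for the distance, \<open>K * r\<close>.\<close>
  obtain N :: nat where N: "N > 2 * K / \<delta>"
    using reals_Archimedean2 by blast
  have "2 * K / \<delta> > 0" using assms by simp
  then have "N > 0" using N by linarith
  then have N': "K * (1 / N) \<le> \<delta> / 2"
    using N \<open>\<delta> > 0\<close> by (simp add: field_simps)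
  define r where "r = \<delta> / (2 * K)"
  have r: "r > 0" "K * r = \<delta> / 2"
    using assms by (auto simp: r_def)
  show ?thesis
  proof (intro exI[of _ r] conjI allI impI r)
    fix l a
    assume a: "\<forall>zs\<in>multichains (small S' \<delta>) (Suc l). cobd a zs = 0"
    let ?F = "\<lambda>i::nat. image (F (i / N))"
    have "\<exists>c. \<forall>xs\<in>multichains (small S r) l.
        a (map (?F 0) xs) + a (map (?F i) xs) = cobd c xs" if "i \<le> N" for i
      using that
    proof (induction i)
      case 0
      show ?case by (rule exI[of _ "\<lambda>_. 0"]) simp
    next
      case (Suc i)
      have b: "0 \<le> real i / N" "real i / N \<le> 1" "0 \<le> real (Suc i) / N" "real (Suc i) / N \<le> 1"
        "\<bar>real i / N - real (Suc i) / N\<bar> = 1 / N"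
        using Suc.prems \<open>N > 0\<close> by (auto simp: field_simps)
      have dd: "K * (dist x y + q) \<le> \<delta>" if "dist x y \<le> r" "q \<le> 1 / N" for x y :: 'a and q
      proof -
        have "K * (dist x y + q) \<le> K * (r + 1 / N)"
          using that \<open>K > 0\<close> by (intro mult_left_mono) auto
        also have "\<dots> \<le> \<delta>"
          using r N' unfolding distrib_left by linarith
        finally show ?thesis .
      qed
      have "\<exists>c. \<forall>xs\<in>multichains (small S r) l.
        a (map (?F i) xs) + a (map (?F (Suc i)) xs) = cobd c xs"
      proof (rule image_homotopy[where S' = S' and r' = \<delta>])
        fix x y assume xy: "x \<in> S" "y \<in> S" "dist x y \<le> r"
        show "dist (F (i / N) x) (F (i / N) y) \<le> \<delta> \<and>
            dist (F (i / N) x) (F (Suc i / N) y) \<le> \<delta> \<and>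
            dist (F (Suc i / N) x) (F (Suc i / N) y) \<le> \<delta>"
          using K[OF b(1,2) b(1,2) xy(1,2)] K[OF b(1-4) xy(1,2)] K[OF b(3,4) b(3,4) xy(1,2)]
            dd[OF xy(3), of 0] dd[OF xy(3), of "1 / N"] b(5) by simp
      qed (use S' b a in auto)
      then obtain c where c: "\<forall>xs\<in>multichains (small S r) l.
          a (map (?F i) xs) + a (map (?F (Suc i)) xs) = cobd c xs" by blast
      obtain c' where c': "\<forall>xs\<in>multichains (small S r) l.
          a (map (?F 0) xs) + a (map (?F i) xs) = cobd c' xs"
        using Suc by auto
      have "a (map (?F 0) xs) + a (map (?F (Suc i)) xs) = cobd (\<lambda>ys. c' ys + c ys) xs"
        if "xs \<in> multichains (small S r) l" for xs
        using bit_add_trans[OF c'[rule_format, OF that] c[rule_format, OF that]]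
        by (simp only: cobd_add)
      then show ?case by blast
    qed
    from this[of N] show "\<exists>c. \<forall>xs\<in>multichains (small S r) l.
        a (map (image (F 0)) xs) + a (map (image (F 1)) xs) = cobd c xs"
      using \<open>N > 0\<close> by simp
  qed
qed

section \<open>Radial projection and acyclicity of coordinate subspheres\<close>

lemma dist_sgn_le:
  fixes x y :: "'a::real_normed_vector"
  assumes "norm x \<ge> 1/2" "norm y \<ge> 1/2"
  shows "dist (sgn x) (sgn y) \<le> 4 * dist x y"
proof -
  have nz: "norm x > 0" "norm y > 0" using assms by linarith+
  have "sgn x - sgn y = (x - y) /\<^sub>R norm x + ((norm y - norm x) / (norm x * norm y)) *\<^sub>R y"
  proof -
    have "1 / norm x - (norm y - norm x) / (norm x * norm y) = 1 / norm y"
      using nz by (simp add: field_simps)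
    then have "y /\<^sub>R norm y = (1 / norm x) *\<^sub>R y - ((norm y - norm x) / (norm x * norm y)) *\<^sub>R y"
      by (simp flip: scaleR_left_diff_distrib add: inverse_eq_divide)
    then show ?thesis
      by (simp add: sgn_div_norm scaleR_diff_right inverse_eq_divide)
  qed
  then have "dist (sgn x) (sgn y) \<le>
      norm ((x - y) /\<^sub>R norm x) + norm (((norm y - norm x) / (norm x * norm y)) *\<^sub>R y)"
    by (metis dist_norm norm_triangle_ineq)
  also have "\<dots> = (dist x y + \<bar>norm y - norm x\<bar>) / norm x"
    using nz by (simp add: dist_norm abs_mult divide_inverse distrib_left distrib_right)
  also have "\<dots> \<le> (2 * dist x y) / norm x"
    using nz norm_triangle_ineq3[of y x] by (intro divide_right_mono) (auto simp: dist_norm norm_minus_commute)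
  also have "\<dots> \<le> (2 * dist x y) / (1/2)"
    using assms by (intro divide_left_mono) auto
  finally show ?thesis by simp
qed

text \<open>For \<open>B \<subseteq> Basis\<close> a sphere of dimension \<open>card B - 1\<close>;
  the dimension thus varies inside one type, which permits induction on it.\<close>

definition subsphere :: "'a::euclidean_space set \<Rightarrow> 'a set" where
  "subsphere B = {x. norm x = 1 \<and> (\<forall>b\<in>Basis - B. x \<bullet> b = 0)}"

lemma subsphere_Basis: "subsphere Basis = sphere 0 1"
  by (auto simp: subsphere_def)

text \<open>The cap contracts to \<open>c\<close> along straight segments projected radially. The
  bound -1/2 keeps the segments away from the origin, so that the projection is Lipschitz on
  them.\<close>

lemma cap_acyclic:
  fixes c :: "'a::euclidean_space"
  assumes c: "c \<in> subsphere B" and "\<delta> > 0"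
  shows "\<exists>r>0. \<forall>l a. (\<forall>zs\<in>multichains (small (subsphere B) \<delta>) (Suc l). cobd a zs = 0) \<longrightarrow>
           (\<exists>b. \<forall>xs\<in>multichains (small {x \<in> subsphere B. x \<bullet> c \<ge> -1/2} r) l. a xs = cobd b xs)"
proof -
  let ?U = "{x \<in> subsphere B. x \<bullet> c \<ge> -1/2}"
  define G where "G t x = (1 - t) *\<^sub>R x + t *\<^sub>R c" for t and x :: 'a
  have nc: "norm c = 1" using c by (simp add: subsphere_def)
  have G: "norm (G t x) \<ge> 1/2" if "0 \<le> t" "t \<le> 1" "x \<in> ?U" for t :: real and x
  proof -
    have nx: "norm x = 1" using that by (simp add: subsphere_def)
    have "x \<bullet> x = 1" "c \<bullet> c = 1"
      using nx nc by (simp_all add: norm_eq_1)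
    then have "(norm (G t x))\<^sup>2 = (1 - t)\<^sup>2 + t\<^sup>2 + 2 * (t * (1 - t)) * (x \<bullet> c)"
      unfolding G_def power2_norm_eq_inner
      by (simp add: inner_add_left inner_add_right inner_commute[of c x] power2_eq_square)
        (simp add: algebra_simps)?
    moreover have "t * (1 - t) * (x \<bullet> c) \<ge> t * (1 - t) * (-1/2)"
      using that by (intro mult_left_mono) auto
    \<comment> \<open>The left side is the squared norm in the extreme case
      \<open>x \<bullet> c = -1/2\<close>; it is least at \<open>t = 1/2\<close>.\<close>
    moreover have "(1 - t)\<^sup>2 + t\<^sup>2 - t * (1 - t) = 1/4 + 3 * (t - 1/2)\<^sup>2"
      by (simp add: power2_eq_square field_simps)
    moreover have "(t - 1/2)\<^sup>2 \<ge> 0" by simp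
    ultimately have "(norm (G t x))\<^sup>2 \<ge> 1/4" by argo
    then have "(1/2)\<^sup>2 \<le> (norm (G t x))\<^sup>2" by (simp add: power2_eq_square)
    then show ?thesis by (rule power2_le_imp_le) simp
  qed
  have GL: "dist (G s x) (G t y) \<le> dist x y + 2 * \<bar>s - t\<bar>"
    if "0 \<le> s" "s \<le> 1" "x \<in> ?U" "y \<in> ?U" for s t :: real and x y
  proof -
    have "G s x - G t y = (1 - s) *\<^sub>R (x - y) + ((t - s) *\<^sub>R y + (s - t) *\<^sub>R c)"
      by (simp add: G_def algebra_simps)
    then have "dist (G s x) (G t y) \<le> norm ((1 - s) *\<^sub>R (x - y)) + (norm ((t - s) *\<^sub>R y) + norm ((s - t) *\<^sub>R c))"
      unfolding dist_norm by (metis norm_triangle_ineq norm_triangle_mono order_refl)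
    also have "\<dots> = (1 - s) * dist x y + 2 * \<bar>s - t\<bar>"
      using that nc by (simp add: subsphere_def dist_norm)
    also have "\<dots> \<le> dist x y + 2 * \<bar>s - t\<bar>"
      using that by (simp add: algebra_simps)
    finally show ?thesis .
  qed
  let ?F = "\<lambda>t x. sgn (G t x)"
  have "\<exists>r>0. \<forall>l a. (\<forall>zs\<in>multichains (small (subsphere B) \<delta>) (Suc l). cobd a zs = 0) \<longrightarrow>
           (\<exists>b. \<forall>xs\<in>multichains (small ?U r) l.
              a (map (image (?F 0)) xs) + a (map (image (?F 1)) xs) = cobd b xs)"
  proof (rule lipschitz_homotopy[where K = 8])
    fix t :: real and x assume tx: "0 \<le> t" "t \<le> 1" "x \<in> ?U"
    have "norm (sgn (G t x)) = 1"
      using G[OF tx] by (auto simp: norm_sgn)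
    then show "?F t x \<in> subsphere B"
      using tx c by (auto simp: subsphere_def sgn_div_norm G_def inner_add_left)
  next
    fix s t :: real and x y assume *: "0 \<le> s" "s \<le> 1" "0 \<le> t" "t \<le> 1" "x \<in> ?U" "y \<in> ?U"
    have "dist (?F s x) (?F t y) \<le> 4 * dist (G s x) (G t y)"
      by (rule dist_sgn_le) (use G * in auto)
    also have "\<dots> \<le> 4 * (dist x y + 2 * \<bar>s - t\<bar>)"
      using GL[of s x y t] * by simp
    finally show "dist (?F s x) (?F t y) \<le> 8 * (dist x y + \<bar>s - t\<bar>)"
      using zero_le_dist[of x y] by argo
  qed (use assms in auto)
  then obtain r where r: "r > 0" "\<And>l a. (\<forall>zs\<in>multichains (small (subsphere B) \<delta>) (Suc l). cobd a zs = 0) \<Longrightarrow>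
           (\<exists>b. \<forall>xs\<in>multichains (small ?U r) l.
              a (map (image (?F 0)) xs) + a (map (image (?F 1)) xs) = cobd b xs)"
    by blast
  show ?thesis
  proof (intro exI[of _ r] conjI r(1) allI impI)
    fix l a
    assume a: "\<forall>zs\<in>multichains (small (subsphere B) \<delta>) (Suc l). cobd a zs = 0"
    obtain b where b: "\<And>xs. xs \<in> multichains (small ?U r) l \<Longrightarrow>
              a (map (image (?F 0)) xs) + a (map (image (?F 1)) xs) = cobd b xs"
      using r(2)[OF a] by blast
    \<comment> \<open>The contraction ends at a constant list of \<open>{c}\<close>. There
      \<open>a\<close> is the coboundary of the cochain that appends one more \<open>{c}\<close>,
      since \<open>cobd a\<close> vanishes on the longer list.\<close>
    have "a xs = cobd (\<lambda>ys. b ys + a (replicate (length ys) {c} @ [{c}])) xs"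
      if xs: "xs \<in> multichains (small ?U r) l" for xs
    proof -
      have "image (?F 0) e = e" "image (?F 1) e = {c}" if "e \<in> set xs" for e
      proof -
        have e: "e \<noteq> {}" "\<And>x. x \<in> e \<Longrightarrow> norm x = 1"
          using that xs by (auto simp: multichains_def small_def subsphere_def)
        have "?F 0 x = x" "?F 1 x = c" if "x \<in> e" for x
          using e that nc by (auto simp: G_def sgn_div_norm)
        then show "image (?F 0) e = e" "image (?F 1) e = {c}"
          using e by auto
      qed
      then have "map (image (?F 0)) xs = xs" "map (image (?F 1)) xs = replicate l {c}"
        using xs by (auto simp: map_idI multichains_def intro: replicate_eqI)
      then have 1: "a xs + a (replicate l {c}) = cobd b xs"
        using b[OF xs] by simp
      have "sorted_wrt (\<le>) (replicate l {c})" by (induction l) auto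
      then have "replicate l {c} @ [{c}] \<in> multichains (small (subsphere B) \<delta>) (Suc l)"
        using c \<open>\<delta> > 0\<close>
        by (auto simp: multichains_def small_def sorted_wrt_append set_replicate_conv_if split: if_splits)
      then have "cobd a (replicate l {c} @ [{c}]) = 0"
        using a by blast
      then have 2: "cobd (\<lambda>ys. a (ys @ [{c}])) (replicate l {c}) = a (replicate l {c})"
        by (simp add: cobd_snoc bit_add_eq_0_iff)
      have "(\<lambda>ys. a (replicate (length ys) {c} @ [{c}])) = (\<lambda>ys. a (map (\<lambda>_. {c}) ys @ [{c}]))"
        by (simp add: map_replicate_const)
      then have "cobd (\<lambda>ys. a (replicate (length ys) {c} @ [{c}])) xs = a (replicate l {c})"
        using 2 cobd_map[of "\<lambda>ys. a (ys @ [{c}])" "\<lambda>_. {c}" xs] xs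
        by (simp add: map_replicate_const multichains_def)
      then show ?thesis
        using 1 by (simp add: cobd_add bit_add_eq_iff)
    qed
    then show "\<exists>b. \<forall>xs\<in>multichains (small ?U r) l. a xs = cobd b xs"
      by blast
  qed
qed


text \<open>
  A cocycle on \<open>\<delta>\<close>-small sets becomes a coboundary on \<open>r\<close>-small ones. The list \<open>[]\<close> counts as a
  simplex, so this is reduced cohomology, with lists of length \<open>l\<close> in degree \<open>l - 1\<close>; the scale \<open>r\<close>
  must not depend on the cocycle.
\<close>

definition acyclic_at :: "'a::metric_space set \<Rightarrow> nat \<Rightarrow> bool" where
  "acyclic_at S l \<longleftrightarrow> (\<forall>\<delta>>0. \<exists>r>0. \<forall>a.
     (\<forall>zs\<in>multichains (small S \<delta>) (Suc l). cobd a zs = 0) \<longrightarrow>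
     (\<exists>c. \<forall>xs\<in>multichains (small S r) l. a xs = cobd c xs))"

text \<open>The band is pushed onto the equator \<open>subsphere B\<close> by shrinking the
  coordinate along \<open>b\<close> and projecting radially. Estimating the norm of
  \<open>G t x\<close> only by 1/2 doubles the bound on that coordinate, hence the two
  widths.\<close>

lemma band_acyclic:
  fixes b :: "'a::euclidean_space"
  assumes b: "b \<in> Basis" "b \<notin> B" and B: "acyclic_at (subsphere B) l" and "\<delta> > 0"
  defines "D \<equiv> \<lambda>q. {x \<in> subsphere (insert b B). \<bar>x \<bullet> b\<bar> \<le> q}"
  shows "\<exists>r>0. \<forall>a. (\<forall>zs\<in>multichains (small (D (1/2)) \<delta>) (Suc l). cobd a zs = 0) \<longrightarrow>
           (\<exists>c. \<forall>xs\<in>multichains (small (D (1/4)) r) l. a xs = cobd c xs)"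
proof -
  define G where "G t x = x - (t * (x \<bullet> b)) *\<^sub>R b" for t :: real and x
  have bb: "b \<bullet> b = 1" "norm b = 1" using b by simp_all
  have G: "norm (G t x) \<ge> 1/2" if "0 \<le> t" "t \<le> 1" "x \<in> D (1/4)" for t x
  proof -
    have "\<bar>t\<bar> * \<bar>x \<bullet> b\<bar> \<le> 1 * (1/4)"
      using that by (intro mult_mono) (auto simp: D_def)
    then have "norm ((t * (x \<bullet> b)) *\<^sub>R b) \<le> 1/4"
      by (simp add: bb abs_mult)
    then show ?thesis
      using norm_triangle_ineq2[of x "(t * (x \<bullet> b)) *\<^sub>R b"] that
      by (simp add: G_def D_def subsphere_def)
  qed
  have GL: "dist (G s x) (G t y) \<le> 2 * dist x y + \<bar>s - t\<bar>"
    if "0 \<le> s" "s \<le> 1" "x \<in> D (1/4)" "y \<in> D (1/4)" for s t x y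
  proof -
    have 1: "\<bar>s * ((x - y) \<bullet> b)\<bar> \<le> dist x y"
    proof -
      have "\<bar>s * ((x - y) \<bullet> b)\<bar> \<le> 1 * (norm (x - y) * norm b)"
        unfolding abs_mult using that by (intro mult_mono Cauchy_Schwarz_ineq2) auto
      then show ?thesis by (simp add: bb dist_norm)
    qed
    have "\<bar>(s - t) * (y \<bullet> b)\<bar> \<le> \<bar>s - t\<bar> * 1"
      unfolding abs_mult using that by (intro mult_left_mono) (auto simp: D_def)
    with 1 have "\<bar>s * ((x - y) \<bullet> b) + (s - t) * (y \<bullet> b)\<bar> \<le> dist x y + \<bar>s - t\<bar>"
      by (intro order_trans[OF abs_triangle_ineq add_mono]) auto
    then have 2: "norm ((s * ((x - y) \<bullet> b) + (s - t) * (y \<bullet> b)) *\<^sub>R b) \<le> dist x y + \<bar>s - t\<bar>"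
      by (simp add: bb)
    have "G s x - G t y = (x - y) - (s * ((x - y) \<bullet> b) + (s - t) * (y \<bullet> b)) *\<^sub>R b"
      by (simp add: G_def algebra_simps inner_diff_left)
    then have "dist (G s x) (G t y) \<le>
        dist x y + norm ((s * ((x - y) \<bullet> b) + (s - t) * (y \<bullet> b)) *\<^sub>R b)"
      unfolding dist_norm by (metis norm_triangle_ineq4)
    then show ?thesis using 2 by linarith
  qed
  let ?F = "\<lambda>t x. sgn (G t x)"
  have FL: "dist (?F s x) (?F t y) \<le> 8 * (dist x y + \<bar>s - t\<bar>)"
    if *: "0 \<le> s" "s \<le> 1" "0 \<le> t" "t \<le> 1" "x \<in> D (1/4)" "y \<in> D (1/4)" for s t x y
  proof -
    have "dist (?F s x) (?F t y) \<le> 4 * dist (G s x) (G t y)"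
      by (rule dist_sgn_le) (use G * in auto)
    also have "\<dots> \<le> 4 * (2 * dist x y + \<bar>s - t\<bar>)"
      using GL[of s x y t] * by simp
    finally show ?thesis by argo
  qed
  have Fb: "?F t x \<bullet> b = (1 - t) * (x \<bullet> b) / norm (G t x)" for t x
    by (simp add: sgn_div_norm G_def bb inner_diff_left algebra_simps divide_inverse)
  have FD: "?F t x \<in> D (1/2)" if tx: "0 \<le> t" "t \<le> 1" "x \<in> D (1/4)" for t x
  proof -
    have "norm (?F t x) = 1"
      using G[OF tx] by (auto simp: norm_sgn)
    then have "?F t x \<in> subsphere (insert b B)"
      using tx b by (auto simp: D_def subsphere_def sgn_div_norm G_def inner_diff_left inner_Basis)
    moreover have "\<bar>?F t x \<bullet> b\<bar> \<le> 1/2"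
    proof -
      have "\<bar>(1 - t) * (x \<bullet> b)\<bar> \<le> 1 * (1/4)"
        unfolding abs_mult using tx by (intro mult_mono) (auto simp: D_def)
      also have "\<dots> \<le> 1/2 * norm (G t x)"
        using G[OF tx] by simp
      finally show ?thesis
        using G[OF tx] unfolding Fb abs_divide abs_norm_cancel by (simp add: divide_le_eq)
    qed
    ultimately show ?thesis by (simp add: D_def)
  qed
  have F1: "?F 1 x \<in> subsphere B" if "x \<in> D (1/4)" for x
    using FD[of 1 x] Fb[of 1 x] that by (auto simp: D_def subsphere_def)
  have BD: "subsphere B \<subseteq> D (1/2)"
    using b by (auto simp: D_def subsphere_def)
  have "\<exists>r>0. \<forall>l a. (\<forall>zs\<in>multichains (small (D (1/2)) \<delta>) (Suc l). cobd a zs = 0) \<longrightarrow>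
           (\<exists>c. \<forall>xs\<in>multichains (small (D (1/4)) r) l.
              a (map (image (?F 0)) xs) + a (map (image (?F 1)) xs) = cobd c xs)"
    by (rule lipschitz_homotopy[where K = 8]) (use FD FL assms in auto)
  then obtain r where r: "r > 0"
      "\<And>l a. (\<forall>zs\<in>multichains (small (D (1/2)) \<delta>) (Suc l). cobd a zs = 0) \<Longrightarrow>
         (\<exists>c. \<forall>xs\<in>multichains (small (D (1/4)) r) l.
            a (map (image (?F 0)) xs) + a (map (image (?F 1)) xs) = cobd c xs)"
    by blast
  obtain r' where r': "r' > 0"
      "\<And>a. (\<forall>zs\<in>multichains (small (subsphere B) \<delta>) (Suc l). cobd a zs = 0) \<Longrightarrow>
        (\<exists>c. \<forall>xs\<in>multichains (small (subsphere B) r') l. a xs = cobd c xs)"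
    using B \<open>\<delta> > 0\<close> unfolding acyclic_at_def by blast
  \<comment> \<open>The retraction is Lipschitz with constant 8, so it carries
    \<open>r' / 8\<close>-small sets to \<open>r'\<close>-small ones.\<close>
  define q where "q = min r (r' / 8)"
  show ?thesis
  proof (intro exI[of _ q] conjI allI impI)
    show "q > 0" using r(1) r'(1) by (simp add: q_def)
    fix a assume a: "\<forall>zs\<in>multichains (small (D (1/2)) \<delta>) (Suc l). cobd a zs = 0"
    obtain c where c: "\<And>xs. xs \<in> multichains (small (D (1/4)) r) l \<Longrightarrow>
            a (map (image (?F 0)) xs) + a (map (image (?F 1)) xs) = cobd c xs"
      using r(2)[OF a] by blast
    have "multichains (small (subsphere B) \<delta>) (Suc l) \<subseteq> multichains (small (D (1/2)) \<delta>) (Suc l)"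
      by (intro multichains_mono small_mono BD order_refl)
    then obtain c' where c': "\<And>xs. xs \<in> multichains (small (subsphere B) r') l \<Longrightarrow> a xs = cobd c' xs"
      using r'(2)[of a] a by blast
    have "a xs = cobd (\<lambda>ys. c ys + c' (map (image (?F 1)) ys)) xs"
      if xs: "xs \<in> multichains (small (D (1/4)) q) l" for xs
    proof -
      have "image (?F 0) e = e" if "e \<in> set xs" for e
      proof -
        have "\<And>x. x \<in> e \<Longrightarrow> norm x = 1"
          using that xs by (auto simp: multichains_def small_def D_def subsphere_def)
        then show ?thesis by (auto simp: G_def sgn_div_norm)
      qed
      then have "map (image (?F 0)) xs = xs"
        by (auto simp: map_idI)
      moreover have "xs \<in> multichains (small (D (1/4)) r) l"
        using xs multichains_mono[OF small_mono[of "D (1/4)" "D (1/4)" q r]] by (auto simp: q_def)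
      ultimately have 1: "a xs + a (map (image (?F 1)) xs) = cobd c xs"
        using c by force
      have "image (?F 1) e \<in> small (subsphere B) r'" if "e \<in> small (D (1/4)) q" for e
      proof (rule image_small[OF that F1])
        fix x y assume xy: "x \<in> D (1/4)" "y \<in> D (1/4)" "dist x y \<le> q"
        show "dist (?F 1 x) (?F 1 y) \<le> r'"
          using FL[of 1 1 x y] xy by (simp add: q_def)
      qed
      then have "map (image (?F 1)) xs \<in> multichains (small (subsphere B) r') l"
        by (rule multichains_map[OF xs _ monotone_on_image])
      then show ?thesis
        using 1 c' by (simp add: cobd_add cobd_map bit_add_eq_iff)
    qed
    then show "\<exists>c. \<forall>xs\<in>multichains (small (D (1/4)) q) l. a xs = cobd c xs"
      by blast
  qed
qed

text \<open>Mayer--Vietoris for the two caps around \<open>b\<close> and \<open>- b\<close>, which overlap in a band.\<close>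

lemma subsphere_acyclic_at_insert:
  fixes b :: "'a::euclidean_space"
  assumes b: "b \<in> Basis" "b \<notin> B" and B: "acyclic_at (subsphere B) l"
  shows "acyclic_at (subsphere (insert b B)) (Suc l)"
  unfolding acyclic_at_def
proof (intro allI impI)
  fix \<delta> :: real assume "\<delta> > 0"
  let ?S = "subsphere (insert b B)"
  let ?D = "\<lambda>q. {x \<in> ?S. \<bar>x \<bullet> b\<bar> \<le> q}"
  let ?U = "{x \<in> ?S. x \<bullet> b \<ge> -1/2}" and ?L = "{x \<in> ?S. x \<bullet> (- b) \<ge> -1/2}"
  have bS: "b \<in> ?S" "- b \<in> ?S"
    using b by (auto simp: subsphere_def inner_Basis)
  from cap_acyclic[OF bS(1) \<open>\<delta> > 0\<close>] obtain r1 where r1: "r1 > 0"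
    "\<And>l a. (\<forall>zs\<in>multichains (small ?S \<delta>) (Suc l). cobd a zs = 0) \<Longrightarrow>
           (\<exists>b. \<forall>xs\<in>multichains (small ?U r1) l. a xs = cobd b xs)" by blast
  from cap_acyclic[OF bS(2) \<open>\<delta> > 0\<close>] obtain r2 where r2: "r2 > 0"
    "\<And>l a. (\<forall>zs\<in>multichains (small ?S \<delta>) (Suc l). cobd a zs = 0) \<Longrightarrow>
           (\<exists>b. \<forall>xs\<in>multichains (small ?L r2) l. a xs = cobd b xs)" by blast
  have "min r1 r2 > 0" using r1 r2 by simp
  from band_acyclic[OF b B this] obtain r3 where r3: "r3 > 0"
    "\<And>a. (\<forall>zs\<in>multichains (small (?D (1/2)) (min r1 r2)) (Suc l). cobd a zs = 0) \<Longrightarrow>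
           (\<exists>c. \<forall>xs\<in>multichains (small (?D (1/4)) r3) l. a xs = cobd c xs)" by blast
  \<comment> \<open>The entry \<open>1/4\<close> is the half-width of the narrow band: a small set
    crossing the equator must stay below its upper edge.\<close>
  define r where "r = Min {r1, r2, r3, 1/4}"
  have r: "r > 0" "r \<le> r1" "r \<le> r2" "r \<le> r3" "r \<le> 1/4"
    using r1(1) r2(1) r3(1) by (auto simp: r_def)
  show "\<exists>r>0. \<forall>a. (\<forall>zs\<in>multichains (small ?S \<delta>) (Suc (Suc l)). cobd a zs = 0) \<longrightarrow>
     (\<exists>c. \<forall>xs\<in>multichains (small ?S r) (Suc l). a xs = cobd c xs)"
  proof (intro exI[of _ r] conjI r(1) allI impI)
    fix a assume a: "\<forall>zs\<in>multichains (small ?S \<delta>) (Suc (Suc l)). cobd a zs = 0"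
    obtain u where u: "\<And>xs. xs \<in> multichains (small ?U r1) (Suc l) \<Longrightarrow> a xs = cobd u xs"
      using r1(2)[OF a] by blast
    obtain v where v: "\<And>xs. xs \<in> multichains (small ?L r2) (Suc l) \<Longrightarrow> a xs = cobd v xs"
      using r2(2)[OF a] by blast
    \<comment> \<open>On the overlap \<open>u\<close> and \<open>v\<close> both have coboundary
      \<open>a\<close>, so they differ by a cocycle one degree lower.\<close>
    have "cobd (\<lambda>ys. u ys + v ys) zs = 0"
      if zs: "zs \<in> multichains (small (?D (1/2)) (min r1 r2)) (Suc l)" for zs
    proof -
      have "small (?D (1/2)) (min r1 r2) \<subseteq> small ?U r1" "small (?D (1/2)) (min r1 r2) \<subseteq> small ?L r2"
        by (intro small_mono; force)+
      then have "a zs = cobd u zs" "a zs = cobd v zs"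
        using u v multichains_mono zs by blast+
      then show ?thesis by (simp add: cobd_add)
    qed
    then obtain w where w: "\<And>xs. xs \<in> multichains (small (?D (1/4)) r3) l \<Longrightarrow>
        u xs + v xs = cobd w xs"
      using r3(2)[of "\<lambda>ys. u ys + v ys"] by blast
    define P where "P xs \<longleftrightarrow> (\<forall>e\<in>set xs. \<forall>x\<in>e. x \<bullet> b \<ge> 0)" for xs
    \<comment> \<open>Gluing: multichains in the upper half take \<open>u\<close> corrected by
      \<open>cobd w\<close>, all others take \<open>v\<close>. If a list is not in the upper half
      but one of its faces is, this face lies in the narrow band, where both prescriptions
      agree.\<close>
    define c where "c ys = (if P ys then u ys + cobd w ys else v ys)" for ys
    \<comment> \<open>Any two members are nested, so their points lie in one \<open>r\<close>-small
      set, and a point below the equator keeps the others at height at most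
      \<open>1/4\<close>.\<close>
    have lower: "x \<bullet> b \<le> 1/4" if xs: "xs \<in> multichains (small ?S r) (Suc l)" "\<not> P xs"
        "e \<in> set xs" "x \<in> e" for xs e x
    proof -
      obtain e' y where y: "e' \<in> set xs" "y \<in> e'" "y \<bullet> b < 0"
        using xs by (auto simp: P_def not_le)
      have "e \<subseteq> e' \<or> e' \<subseteq> e"
      proof -
        obtain i j where "i < length xs" "j < length xs" "xs ! i = e" "xs ! j = e'"
          using xs(3) y(1) by (auto simp: in_set_conv_nth)
        then show ?thesis
          using xs(1) unfolding multichains_def sorted_wrt_iff_nth_less
          by (metis (mono_tags, lifting) linorder_neqE_nat mem_Collect_eq order_refl)
      qed
      moreover have "e \<in> small ?S r" "e' \<in> small ?S r"
        using xs y by (auto simp: multichains_def)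
      ultimately have "dist x y \<le> r"
        using xs(4) y(2) smallD by blast
      moreover have "x \<bullet> b - y \<bullet> b \<le> dist x y"
        using Basis_le_norm[OF b(1), of "x - y"] by (simp add: dist_norm inner_diff_left)
      ultimately show ?thesis using y r by linarith
    qed
    have "a xs = cobd c xs" if xs: "xs \<in> multichains (small ?S r) (Suc l)" for xs
    proof (cases "P xs")
      case True
      have "cobd c xs = cobd (\<lambda>ys. u ys + cobd w ys) xs"
        by (rule cobd_cong_faces)
          (use True in \<open>auto simp: c_def P_def dest!: in_set_takeD in_set_dropD\<close>)
      moreover have "set xs \<subseteq> small ?U r1"
      proof
        fix e assume e: "e \<in> set xs"
        then have "e \<in> small ?S r" using xs by (auto simp: multichains_def)
        then show "e \<in> small ?U r1"
          by (rule small_restrict[OF _ r(2)]) (use True e in \<open>force simp: P_def\<close>)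
      qed
      then have "xs \<in> multichains (small ?U r1) (Suc l)"
        using xs by (auto simp: multichains_def)
      ultimately show ?thesis by (simp add: cobd_add u)
    next
      case False
      have "set xs \<subseteq> small ?L r2"
      proof
        fix e assume e: "e \<in> set xs"
        then have "e \<in> small ?S r" using xs by (auto simp: multichains_def)
        then show "e \<in> small ?L r2"
          by (rule small_restrict[OF _ r(3)]) (use lower[OF xs False e] in force)
      qed
      then have xL: "xs \<in> multichains (small ?L r2) (Suc l)"
        using xs by (auto simp: multichains_def)
      have "cobd c xs = cobd v xs"
      proof (rule cobd_cong_faces)
        fix i assume i: "i < length xs"
        define ys where "ys = take i xs @ drop (Suc i) xs"
        have ys: "ys \<in> multichains (small ?S r) l" "set ys \<subseteq> set xs"
          using multichains_face[OF xs] i xs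
          by (auto simp: ys_def multichains_def dest: in_set_takeD in_set_dropD)
        have "c ys = v ys"
        proof (cases "P ys")
          case True
          have "set ys \<subseteq> small (?D (1/4)) r3"
          proof
            fix e assume e: "e \<in> set ys"
            then have "e \<in> small ?S r" using ys by (auto simp: multichains_def)
            then show "e \<in> small (?D (1/4)) r3"
            proof (rule small_restrict[OF _ r(4)])
              fix x assume x: "x \<in> e" "x \<in> ?S"
              have "x \<bullet> b \<le> 1/4"
                using lower[OF xs False _ x(1)] e ys(2) by blast
              then show "x \<in> ?D (1/4)"
                using True e x by (auto simp: P_def)
            qed
          qed
          then have "ys \<in> multichains (small (?D (1/4)) r3) l"
            using ys by (auto simp: multichains_def)
          then have "u ys = cobd w ys + v ys"
            using w[of ys] by (simp add: bit_add_eq_iff)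
          then show ?thesis
            using True by (simp add: c_def add.commute)
        qed (simp add: c_def)
        then show "c (take i xs @ drop (Suc i) xs) = v (take i xs @ drop (Suc i) xs)"
          by (simp add: ys_def)
      qed
      then show ?thesis using v[OF xL] by simp
    qed
    then show "\<exists>c. \<forall>xs\<in>multichains (small ?S r) (Suc l). a xs = cobd c xs"
      by blast
  qed
qed

text \<open>Reduced degree -1: the cocycle condition at the list \<open>[{x}]\<close> says
  \<open>a [] = 0\<close>.\<close>

lemma acyclic_at_0:
  assumes "x \<in> S"
  shows "acyclic_at S 0"
  unfolding acyclic_at_def
proof (intro allI impI exI[of _ "1::real"] exI[of _ "\<lambda>_. 0"] conjI ballI)
  fix \<delta> :: real and a xs assume "\<delta> > 0"
    and a: "\<forall>zs\<in>multichains (small S \<delta>) (Suc 0). cobd a zs = 0"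
    and xs: "xs \<in> multichains (small S 1) 0"
  have "[{x}] \<in> multichains (small S \<delta>) (Suc 0)"
    using assms \<open>\<delta> > 0\<close> by (simp add: multichains_def small_def)
  then show "a xs = cobd (\<lambda>_. 0) xs"
    using a xs by force
qed simp

text \<open>Each new coordinate is a suspension and shifts the degree by one. The bound
  \<open>l < card B\<close> expresses that the degree \<open>l - 1\<close> is below the
  dimension.\<close>

proposition subsphere_acyclic_at:
  fixes B :: "'a::euclidean_space set"
  assumes "B \<subseteq> Basis" "l < card B"
  shows "acyclic_at (subsphere B) l"
proof -
  have "finite B" using assms finite_Basis finite_subset by blast
  then show ?thesis using assms
  proof (induction B arbitrary: l)
    case (insert b B)
    have "b \<in> subsphere (insert b B)"
      using insert.prems by (auto simp: subsphere_def inner_Basis)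
    then show ?case
    proof (cases l)
      case 0
      then show ?thesis using acyclic_at_0[OF \<open>b \<in> subsphere (insert b B)\<close>] by simp
    next
      case (Suc k)
      then show ?thesis
        using insert.IH[of k] insert.prems insert.hyps subsphere_acyclic_at_insert[of b B k] by simp
    qed
  qed simp
qed

subsection \<open>A combinatorial Borsuk--Ulam theorem\<close>

lemma uminus_image_small:
  fixes e :: "'a::real_normed_vector set"
  shows "e \<in> small (sphere 0 1) r \<Longrightarrow> uminus ` e \<in> small (sphere 0 1) r"
  by (erule image_small) (auto simp: dist_norm norm_minus_commute)

text \<open>Descent on the length, with \<open>T\<close> the antipode. If
  \<open>\<theta> = c + c \<circ> T + cobd k\<close> at length \<open>L + 1\<close>, then there
  \<open>cobd \<theta> = \<theta> + \<theta> \<circ> T\<close> equals the coboundary of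
  \<open>k + k \<circ> T\<close>. By acyclicity \<open>\<theta>\<close> has the same form at length
  \<open>L\<close>, at a smaller scale.\<close>

theorem alternating_not_coboundary:
  fixes h :: "'a::euclidean_space set \<Rightarrow> bool"
  assumes "m < DIM('a)" "\<delta> > 0"
    and h: "\<And>e. e \<in> small (sphere 0 1) \<delta> \<Longrightarrow> h (uminus ` e) \<longleftrightarrow> \<not> h e"
    and k: "\<And>xs. xs \<in> multichains (small (sphere 0 1) \<delta>) (Suc m) \<Longrightarrow>
              of_bool (alternating h True xs) = cobd k xs"
  shows False
proof -
  define \<theta> :: "'a set list \<Rightarrow> bit" where "\<theta> xs = of_bool (alternating h True xs)" for xs
  define T :: "'a set list \<Rightarrow> 'a set list" where "T = map (image uminus)"
  let ?C = "\<lambda>r. multichains (small (sphere (0::'a) 1) r)"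
  have TT: "T (T xs) = xs" for xs
    by (simp add: T_def image_image o_def)
  have TC: "T xs \<in> ?C r l" if "xs \<in> ?C r l" for xs r l
    unfolding T_def using that uminus_image_small monotone_on_image by (rule multichains_map)
  have cobd_\<theta>: "cobd \<theta> xs = \<theta> xs + \<theta> (T xs)" if "xs \<in> ?C r l" "r \<le> \<delta>" for xs r l
  proof -
    have "alternating h True (T xs) = alternating h (\<not> True) xs"
      unfolding T_def
    proof (rule alternating_antisymmetric, rule h)
      fix e assume "e \<in> set xs"
      then show "e \<in> small (sphere 0 1) \<delta>"
        using that small_mono[of "sphere (0::'a) 1" "sphere 0 1" r \<delta>] by (auto simp: multichains_def)
    qed
    then show ?thesis by (simp add: \<theta>_def[abs_def] cobd_alternating)
  qed
  have "\<exists>r c k. 0 < r \<and> r \<le> \<delta> \<and> (\<forall>xs\<in>?C r L. \<theta> xs = c xs + c (T xs) + cobd k xs)" if "L \<le> Suc m" for L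
    using that
  proof (induction rule: inc_induct)
    case base
    show ?case
      by (rule exI[of _ \<delta>], rule exI[of _ "\<lambda>_. 0"], rule exI[of _ k])
        (use \<open>\<delta> > 0\<close> k in \<open>simp add: \<theta>_def\<close>)
  next
    case (step L)
    then obtain r c k where r: "0 < r" "r \<le> \<delta>"
      and k: "\<And>xs. xs \<in> ?C r (Suc L) \<Longrightarrow> \<theta> xs = c xs + c (T xs) + cobd k xs"
      by blast
    have "cobd (\<lambda>xs. \<theta> xs + (k xs + k (T xs))) zs = 0" if zs: "zs \<in> ?C r (Suc L)" for zs
    proof -
      have "cobd \<theta> zs = (c zs + c (T zs) + cobd k zs) + (c (T zs) + c zs + cobd k (T zs))"
        using cobd_\<theta>[OF zs r(2)] k[OF zs] k[OF TC[OF zs]] by (simp add: TT)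
      also have "\<dots> = (c zs + c zs) + (c (T zs) + c (T zs)) + (cobd k zs + cobd k (T zs))"
        by (simp only: ac_simps)
      finally show ?thesis
        using cobd_map[of k "image uminus" zs] by (simp add: cobd_add T_def)
    qed
    then have cocycle: "\<forall>zs\<in>?C r (Suc L). cobd (\<lambda>xs. \<theta> xs + (k xs + k (T xs))) zs = 0"
      by blast
    have "acyclic_at (sphere (0::'a) 1) L"
      using subsphere_acyclic_at[of "Basis :: 'a set" L] step.hyps assms(1) by (simp add: subsphere_Basis)
    then obtain r' where r': "r' > 0"
      "\<And>a. \<forall>zs\<in>?C r (Suc L). cobd a zs = 0 \<Longrightarrow> \<exists>k'. \<forall>xs\<in>?C r' L. a xs = cobd k' xs"
      unfolding acyclic_at_def using r(1) by blast
    obtain k' where k': "\<forall>xs\<in>?C r' L. \<theta> xs + (k xs + k (T xs)) = cobd k' xs"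
      using r'(2)[OF cocycle] by blast
    have "\<theta> xs = k xs + k (T xs) + cobd k' xs" if "xs \<in> ?C (min r r') L" for xs
    proof -
      have "xs \<in> ?C r' L"
        using that multichains_mono[OF small_mono[of "sphere (0::'a) 1" "sphere 0 1" "min r r'" r']] by auto
      then show ?thesis
        using k' bit_add_eq_iff[of "\<theta> xs" "k xs + k (T xs)"] by blast
    qed
    then show ?case
      using r r'(1) by (intro exI[of _ "min r r'"]) auto
  qed
  \<comment> \<open>At \<open>[]\<close>, which \<open>T\<close> fixes, the right side vanishes, but
    \<open>[]\<close> counts as alternating.\<close>
  from this[of 0] obtain r c k where "\<forall>xs\<in>?C r 0. \<theta> xs = c xs + c (T xs) + cobd k xs"
    by auto
  then show False by (simp add: \<theta>_def T_def)
qed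

subsection \<open>Maximal chains in products of ranked posets\<close>

text \<open>The levels \<open>rk\<close> will be chain lengths, absolute values less 2 in
  \<open>H2inf\<close>, or sums of levels in a product.\<close>

locale ranked =
  fixes A :: "'p::order set" and rk :: "'p \<Rightarrow> nat" and d :: nat
  assumes rk_less: "x \<in> A \<Longrightarrow> y \<in> A \<Longrightarrow> x < y \<Longrightarrow> rk x < rk y"
    and rk_le_d: "x \<in> A \<Longrightarrow> rk x \<le> d"
begin

lemma rk_le: "x \<in> A \<Longrightarrow> y \<in> A \<Longrightarrow> x \<le> y \<Longrightarrow> rk x \<le> rk y"
  using rk_less[of x y] by (auto simp: order_le_less)

lemma rk_eqD: "x \<in> A \<Longrightarrow> y \<in> A \<Longrightarrow> x \<le> y \<Longrightarrow> rk y \<le> rk x \<Longrightarrow> x = y"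
  using rk_less[of x y] by (auto simp: order_le_less)

lemma nth_add_le_rk_nth:
  assumes "sorted_wrt (<) xs" "set xs \<subseteq> A" "i + k < length xs"
  shows "rk (xs ! i) + k \<le> rk (xs ! (i + k))"
  using assms(3)
proof (induction k)
  case (Suc k)
  have "rk (xs ! (i + k)) < rk (xs ! (i + Suc k))"
    using Suc.prems assms by (intro rk_less) (auto simp: sorted_wrt_iff_nth_less subset_iff)
  then show ?case using Suc by simp
qed simp

lemma length_strict_chain:
  assumes "sorted_wrt (<) xs" "set xs \<subseteq> A"
  shows "length xs \<le> Suc d"
proof (cases xs)
  case (Cons x ys)
  have "xs ! (length xs - 1) \<in> set xs"
    using Cons by (intro nth_mem) simp
  then have "xs ! (length xs - 1) \<in> A"
    using assms(2) by blast
  then have "rk (xs ! (length xs - 1)) \<le> d"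
    by (rule rk_le_d)
  then show ?thesis
    using nth_add_le_rk_nth[OF assms, of 0 "length xs - 1"] Cons by simp
qed simp

text \<open>There are only \<open>Suc d\<close> levels, so each of them is hit once and in
  order.\<close>

lemma rk_maximal_chain:
  assumes "sorted_wrt (<) xs" "set xs \<subseteq> A" "length xs = Suc d" "i \<le> d"
  shows "rk (xs ! i) = i"
proof -
  have "xs ! d \<in> A"
    using assms by (simp add: subset_iff)
  then have "rk (xs ! d) \<le> d"
    by (rule rk_le_d)
  then show ?thesis
    using nth_add_le_rk_nth[OF assms(1,2), of 0 i] nth_add_le_rk_nth[OF assms(1,2), of i "d - i"] assms
    by simp
qed

end

lemma not_strict_split:
  assumes "sorted_wrt (\<le>) xs" "\<not> sorted_wrt (<) (xs :: 'p::order list)"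
  shows "\<exists>u x v. xs = u @ x # x # v"
proof -
  have "\<not> successively (<) xs" "successively (\<le>) xs"
    using assms by (simp_all add: successively_conv_sorted_wrt transp_on_less successively_if_sorted_wrt)
  then show ?thesis
  proof (induction xs)
    case (Cons y ys)
    then obtain z zs where ys: "ys = z # zs" by (cases ys) auto
    show ?case
    proof (cases "y = z")
      case True
      then show ?thesis using ys by (intro exI[of _ "[]"]) simp
    next
      case False
      then have "\<exists>u x v. ys = u @ x # x # v"
        using Cons by (intro Cons.IH) (auto simp: ys order_less_le)
      then show ?thesis by (metis append_Cons)
    qed
  qed simp
qed

lemma strict_not_repeat: "sorted_wrt (<) (xs :: 'p::order list) \<Longrightarrow> xs \<noteq> u @ x # x # v"
  by (auto simp: sorted_wrt_append)

context ranked
begin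

text \<open>A multichain with \<open>d + 2\<close> members repeats one, whereas the indicator of a
  strict chain vanishes on lists with repetitions.\<close>

lemma indicator_cocycle:
  assumes "sorted_wrt (<) \<sigma>" "zs \<in> multichains A (Suc (Suc d))"
  shows "cobd (\<lambda>ys. of_bool (ys = \<sigma>)) zs = 0"
proof -
  have "\<not> sorted_wrt (<) zs"
    using length_strict_chain[of zs] assms(2) by (auto simp: multichains_def)
  then obtain u x v where zs: "zs = u @ x # x # v"
    using not_strict_split[of zs] assms(2) by (auto simp: multichains_def)
  show ?thesis
    unfolding zs by (rule cobd_normalized) (use strict_not_repeat[OF assms(1)] in auto)
qed

text \<open>The coboundary of the indicator of \<open>\<pi>\<close> without its entry
  \<open>j\<close> counts the ways of filling the gap. Levels force the new entry to stand at place
  \<open>j\<close>, where only two candidates exist.\<close>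

lemma indicator_swap:
  assumes \<pi>: "sorted_wrt (<) \<pi>" "set \<pi> \<subseteq> A" "length \<pi> = Suc d"
    and j: "0 < j" "j < d"
    and \<pi>': "sorted_wrt (<) (\<pi>[j := t])" "t \<noteq> \<pi> ! j"
    and two: "\<And>y. y \<in> A \<Longrightarrow> \<pi> ! (j - 1) < y \<Longrightarrow> y < \<pi> ! (j + 1) \<Longrightarrow> y = \<pi> ! j \<or> y = t"
    and ys: "ys \<in> multichains A (Suc d)"
  shows "of_bool (ys = \<pi>) + of_bool (ys = \<pi>[j := t]) =
           cobd (\<lambda>zs. of_bool (zs = take j \<pi> @ drop (Suc j) \<pi>)) ys"
proof (cases "sorted_wrt (<) ys")
  case False
  then obtain u x v where uxv: "ys = u @ x # x # v"
    using not_strict_split[of ys] ys by (auto simp: multichains_def)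
  have "\<pi> = take j \<pi> @ \<pi> ! j # drop (Suc j) \<pi>"
    using j \<pi> by (simp add: id_take_nth_drop)
  then have "sorted_wrt (<) (take j \<pi> @ drop (Suc j) \<pi>)"
    using \<pi>(1) by (metis (no_types, lifting) in_set_conv_decomp sorted_wrt.simps(2) sorted_wrt_append list.set_intros(2))
  then have "cobd (\<lambda>zs. of_bool (zs = take j \<pi> @ drop (Suc j) \<pi>)) ys = 0"
    unfolding uxv by (intro cobd_normalized) (use strict_not_repeat in \<open>metis of_bool_eq(1)\<close>)
  moreover have "ys \<noteq> \<pi>" "ys \<noteq> \<pi>[j := t]"
    using False \<pi>(1) \<pi>'(1) by auto
  ultimately show ?thesis by simp
next
  case True
  have ysA: "set ys \<subseteq> A" "length ys = Suc d"
    using ys by (auto simp: multichains_def)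
  let ?del = "\<lambda>i xs. take i xs @ drop (Suc i) xs"
  \<comment> \<open>Entry \<open>k\<close> of either chain has level \<open>k\<close>, so the
    missing level reveals which place was omitted.\<close>
  have "?del i ys \<noteq> ?del j \<pi>" if "i < Suc d" "i \<noteq> j" for i
  proof
    assume eq: "?del i ys = ?del j \<pi>"
    have rk: "rk (ys ! k) = k" "rk (\<pi> ! k) = k" if "k \<le> d" for k
      using rk_maximal_chain that True ysA \<pi> by auto
    show False
    proof (cases "i < j")
      case True
      then have "?del i ys ! i = ys ! Suc i" "?del j \<pi> ! i = \<pi> ! i"
        using j \<pi> ysA by (simp_all add: nth_append)
      then show False using eq rk[of i] rk[of "Suc i"] True j by simp
    next
      case False
      then have "?del i ys ! j = ys ! j" "?del j \<pi> ! j = \<pi> ! Suc j"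
        using j \<pi> ysA that by (simp_all add: nth_append)
      then show False using eq rk[of j] rk[of "Suc j"] j by simp
    qed
  qed
  then have "cobd (\<lambda>zs. of_bool (zs = ?del j \<pi>)) ys =
      (\<Sum>i<Suc d. if i = j then of_bool (?del j ys = ?del j \<pi>) else 0)"
    unfolding cobd_eq_sum ysA(2) by (intro sum.cong) auto
  also have "\<dots> = of_bool (?del j ys = ?del j \<pi>)"
    using j by simp
  also have "(?del j ys = ?del j \<pi>) \<longleftrightarrow> ys = \<pi> \<or> ys = \<pi>[j := t]"
  proof
    assume "?del j ys = ?del j \<pi>"
    then have eq: "take j ys = take j \<pi>" "drop (Suc j) ys = drop (Suc j) \<pi>"
      using ysA \<pi> by (simp_all add: append_eq_append_conv)
    have "take j ys ! (j - 1) = take j \<pi> ! (j - 1)" "drop (Suc j) ys ! 0 = drop (Suc j) \<pi> ! 0"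
      using eq by simp_all
    then have "ys ! (j - 1) = \<pi> ! (j - 1)" "ys ! (j + 1) = \<pi> ! (j + 1)"
      using j ysA \<pi> by simp_all
    moreover have "ys ! (j - 1) < ys ! j" "ys ! j < ys ! (j + 1)" "ys ! j \<in> A"
      using True j ysA by (auto simp: sorted_wrt_iff_nth_less subset_iff)
    ultimately have "ys ! j = \<pi> ! j \<or> ys ! j = t"
      using two by simp
    moreover have "ys = take j \<pi> @ ys ! j # drop (Suc j) \<pi>"
      using eq j ysA by (metis id_take_nth_drop less_SucI)
    moreover have "\<pi> = take j \<pi> @ \<pi> ! j # drop (Suc j) \<pi>"
      using j \<pi> by (simp add: id_take_nth_drop)
    moreover have "\<pi>[j := t] = take j \<pi> @ t # drop (Suc j) \<pi>"
      using j \<pi> by (simp add: upd_conv_take_nth_drop)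
    ultimately show "ys = \<pi> \<or> ys = \<pi>[j := t]" by metis
  qed auto
  finally show ?thesis
  proof -
    assume *: "cobd (\<lambda>zs. of_bool (zs = ?del j \<pi>)) ys = of_bool (ys = \<pi> \<or> ys = \<pi>[j := t])"
    have "\<pi> \<noteq> \<pi>[j := t]"
      using \<pi>'(2) j \<pi>(3) by (metis less_SucI nth_list_update_eq)
    then show ?thesis unfolding * by auto
  qed
qed

lemma ranked_Times: "ranked (A \<times> A) (\<lambda>(p, q). rk p + rk q) (2 * d)"
proof
  fix x y :: "'p \<times> 'p"
  assume xy: "x \<in> A \<times> A" "y \<in> A \<times> A" "x < y"
  then have "fst x \<le> fst y" "snd x \<le> snd y" "x \<noteq> y"
    by (auto simp: less_prod_def less_eq_prod_def)
  then have "fst x \<le> fst y \<and> snd x < snd y \<or> fst x < fst y \<and> snd x \<le> snd y"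
    by (auto simp: order_le_less prod_eq_iff)
  then show "(case x of (p, q) \<Rightarrow> rk p + rk q) < (case y of (p, q) \<Rightarrow> rk p + rk q)"
    using xy rk_less rk_le by (auto simp: case_prod_beta intro: add_le_less_mono add_less_le_mono)
next
  fix x assume "x \<in> A \<times> A"
  then show "(case x of (p, q) \<Rightarrow> rk p + rk q) \<le> 2 * d"
    using rk_le_d[of "fst x"] rk_le_d[of "snd x"] by (auto simp: case_prod_beta)
qed

end

section \<open>Staircases in the square of a ranked poset and their classes\<close>

context ranked
begin

text \<open>Every total level is hit and both levels are weakly increasing, so each step raises
  exactly one of them, by one.\<close>

lemma maximal_chain_staircase:
  assumes \<pi>: "sorted_wrt (<) \<pi>" "set \<pi> \<subseteq> A \<times> A" "length \<pi> = Suc (2 * d)"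
  shows "i \<le> 2 * d \<Longrightarrow> \<pi> ! i \<in> A \<times> A"
    and "i \<le> 2 * d \<Longrightarrow> rk (fst (\<pi> ! i)) + rk (snd (\<pi> ! i)) = i"
    and "i \<le> j \<Longrightarrow> j \<le> 2 * d \<Longrightarrow> fst (\<pi> ! i) \<le> fst (\<pi> ! j) \<and> snd (\<pi> ! i) \<le> snd (\<pi> ! j)"
    and "i \<le> j \<Longrightarrow> j \<le> 2 * d \<Longrightarrow> rk (fst (\<pi> ! i)) \<le> rk (fst (\<pi> ! j)) \<and> rk (snd (\<pi> ! i)) \<le> rk (snd (\<pi> ! j))"
proof -
  have mem: "\<pi> ! i \<in> A \<times> A" if "i \<le> 2 * d" for i
    using that \<pi> by (metis le_imp_less_Suc nth_mem subsetD)
  have le: "fst (\<pi> ! i) \<le> fst (\<pi> ! j) \<and> snd (\<pi> ! i) \<le> snd (\<pi> ! j)" if "i \<le> j" "j \<le> 2 * d" for i j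
  proof (cases "i = j")
    case False
    then have "\<pi> ! i < \<pi> ! j"
      using \<pi>(1,3) that by (auto simp: sorted_wrt_iff_nth_less)
    then show ?thesis by (simp add: less_prod_def less_eq_prod_def)
  qed simp
  show "i \<le> 2 * d \<Longrightarrow> \<pi> ! i \<in> A \<times> A"
    "i \<le> j \<Longrightarrow> j \<le> 2 * d \<Longrightarrow> fst (\<pi> ! i) \<le> fst (\<pi> ! j) \<and> snd (\<pi> ! i) \<le> snd (\<pi> ! j)"
    by (fact mem, fact le)
  show "i \<le> 2 * d \<Longrightarrow> rk (fst (\<pi> ! i)) + rk (snd (\<pi> ! i)) = i"
    using ranked.rk_maximal_chain[OF ranked_Times \<pi>, of i] by (simp add: case_prod_beta)
  assume ij: "i \<le> j" "j \<le> 2 * d"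
  show "rk (fst (\<pi> ! i)) \<le> rk (fst (\<pi> ! j)) \<and> rk (snd (\<pi> ! i)) \<le> rk (snd (\<pi> ! j))"
    using mem[of i] mem[of j] le[OF ij] ij by (auto intro!: rk_le simp: mem_Times_iff)
qed

end

text \<open>\<open>Y\<close> and \<open>Y'\<close> stand for the small sets at a coarse and a fine
  scale, \<open>f\<close> and \<open>g\<close> for \<open>r\<close> at a set and at its antipode.
  The degree in \<open>acyclic\<close> is that of a maximal chain of a single factor.\<close>

locale ranked_pair = ranked A rk d for A :: "'p::order set" and rk d +
  fixes Y Y' :: "'y::order set" and f g :: "'y \<Rightarrow> 'p"
  assumes f: "monotone_on Y (\<le>) (\<le>) f" "\<And>y. y \<in> Y \<Longrightarrow> f y \<in> A"
    and g: "monotone_on Y (\<le>) (\<le>) g" "\<And>y. y \<in> Y \<Longrightarrow> g y \<in> A"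
    and Y': "Y' \<subseteq> Y"
    and acyclic: "\<And>a. \<forall>zs\<in>multichains Y (Suc (Suc d)). cobd a zs = 0 \<Longrightarrow>
                    \<exists>c. \<forall>xs\<in>multichains Y' (Suc d). a xs = cobd c xs"
begin

abbreviation fg :: "'y \<Rightarrow> 'p \<times> 'p" where
  "fg y \<equiv> (f y, g y)"

lemma map_fg_mem:
  assumes "xs \<in> multichains Y' l"
  shows "map fg xs \<in> multichains (A \<times> A) l"
proof (rule multichains_map)
  show "xs \<in> multichains Y l" using assms multichains_mono[OF Y'] by blast
  show "monotone_on Y (\<le>) (\<le>) fg" using f g by (auto simp: monotone_on_def less_eq_prod_def)
qed (use f g in auto)

lemma cocycle_pullback:
  assumes "sorted_wrt (<) \<sigma>"
  shows "\<forall>zs\<in>multichains Y (Suc (Suc d)). cobd (\<lambda>ys. of_bool (map f ys = \<sigma>)) zs = 0"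
    and "\<forall>zs\<in>multichains Y (Suc (Suc d)). cobd (\<lambda>ys. of_bool (map g ys = \<sigma>)) zs = 0"
proof -
  have "cobd (\<lambda>ys. of_bool (map f ys = \<sigma>)) zs = 0" "cobd (\<lambda>ys. of_bool (map g ys = \<sigma>)) zs = 0"
    if "zs \<in> multichains Y (Suc (Suc d))" for zs
    unfolding cobd_map[of "\<lambda>ys. of_bool (ys = \<sigma>)"]
    by (rule indicator_cocycle[OF assms]; rule multichains_map[OF that]; use f g in blast)+
  then show "\<forall>zs\<in>multichains Y (Suc (Suc d)). cobd (\<lambda>ys. of_bool (map f ys = \<sigma>)) zs = 0"
    "\<forall>zs\<in>multichains Y (Suc (Suc d)). cobd (\<lambda>ys. of_bool (map g ys = \<sigma>)) zs = 0"
    by blast+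
qed

text \<open>
  The staircase that first exhausts \<open>f\<close> and then \<open>g\<close>: its indicator is the cup product of a cocycle
  in \<open>f\<close> with a cocycle in \<open>g\<close>, and the former is a coboundary.
\<close>

lemma indicator_coboundary_corner:
  assumes \<pi>: "sorted_wrt (<) \<pi>" "set \<pi> \<subseteq> A \<times> A" "length \<pi> = Suc (2 * d)"
    and corner: "rk (fst (\<pi> ! d)) = d"
  shows "\<exists>c. \<forall>xs\<in>multichains Y' (Suc (2 * d)). of_bool (map fg xs = \<pi>) = cobd c xs"
proof -
  note st = maximal_chain_staircase[OF \<pi>]
  have corner': "rk (snd (\<pi> ! d)) = 0" using st(2)[of d] corner by simp
  define \<sigma> where "\<sigma> = map fst (take (Suc d) \<pi>)"
  define \<tau> where "\<tau> = map snd (drop d \<pi>)"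
  define \<alpha> :: "'y list \<Rightarrow> bit" where "\<alpha> ys = of_bool (map f ys = \<sigma>)" for ys
  define \<beta> :: "'y list \<Rightarrow> bit" where "\<beta> ys = of_bool (map g ys = \<tau>)" for ys
  \<comment> \<open>Up to index \<open>d\<close> the second level remains 0, so every step is taken
    in the first coordinate.\<close>
  have "fst (\<pi> ! i) < fst (\<pi> ! j)" if "i < j" "j \<le> d" for i j
    using st(2)[of i] st(2)[of j] st(3,4)[of i j] st(4)[of j d] corner' that
    by (auto simp: order_less_le)
  then have "sorted_wrt (<) \<sigma>"
    using \<pi>(3) by (auto simp: \<sigma>_def sorted_wrt_iff_nth_less)
  then have \<alpha>: "\<forall>zs\<in>multichains Y (Suc (Suc d)). cobd \<alpha> zs = 0"
    unfolding \<alpha>_def[abs_def] by (rule cocycle_pullback)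
  have "snd (\<pi> ! i) < snd (\<pi> ! j)" if "d \<le> i" "i < j" "j \<le> 2 * d" for i j
  proof -
    have "rk (fst (\<pi> ! i)) \<le> d" "rk (fst (\<pi> ! j)) \<le> d"
      using st(1)[of i] st(1)[of j] that by (auto intro!: rk_le_d simp: mem_Times_iff)
    then have "rk (snd (\<pi> ! i)) \<noteq> rk (snd (\<pi> ! j))"
      using st(2)[of i] st(2)[of j] st(4)[of d i] st(4)[of d j] corner that by simp
    then show ?thesis
      using st(3)[of i j] that by (auto simp: order_less_le)
  qed
  then have "sorted_wrt (<) \<tau>"
    using \<pi>(3) by (auto simp: \<tau>_def sorted_wrt_iff_nth_less)
  then have \<beta>: "\<forall>zs\<in>multichains Y (Suc (Suc d)). cobd \<beta> zs = 0"
    unfolding \<beta>_def[abs_def] by (rule cocycle_pullback)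
  \<comment> \<open>At index \<open>d\<close> the first level is maximal and the second minimal. By
    monotonicity \<open>f\<close> is constant from there on and \<open>g\<close> up to there, so the
    two half lists determine all of \<open>map fg xs\<close>.\<close>
  have cup: "of_bool (map fg xs = \<pi>) = \<alpha> (take (Suc d) xs) * \<beta> (drop d xs)"
    if xs: "xs \<in> multichains Y' (Suc (2 * d))" for xs
  proof -
    have len: "length xs = Suc (2 * d)" using xs by (simp add: multichains_def)
    have "map fg xs = \<pi>" if *: "map f (take (Suc d) xs) = \<sigma>" "map g (drop d xs) = \<tau>"
    proof (rule nth_equalityI)
      fix i assume "i < length (map fg xs)"
      then have i: "i \<le> 2 * d" using len by simp
      have fx: "f (xs ! k) = fst (\<pi> ! k)" if "k \<le> d" for k
        using arg_cong[OF *(1), of "\<lambda>ys. ys ! k"] that len \<pi>(3) by (simp add: \<sigma>_def)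
      have gx: "g (xs ! k) = snd (\<pi> ! k)" if "d \<le> k" "k \<le> 2 * d" for k
        using arg_cong[OF *(2), of "\<lambda>ys. ys ! (k - d)"] that len \<pi>(3) by (simp add: \<tau>_def)
      have mem: "xs ! k \<in> Y" if "k \<le> 2 * d" for k
      proof -
        have "xs ! k \<in> set xs" using that len by (intro nth_mem) simp
        then show ?thesis using xs Y' by (auto simp: multichains_def)
      qed
      have mono: "f (xs ! k) \<le> f (xs ! l)" "g (xs ! k) \<le> g (xs ! l)" if "k \<le> l" "l \<le> 2 * d" for k l
      proof -
        have "xs ! k \<le> xs ! l"
          using xs that len by (cases "k = l") (auto simp: multichains_def sorted_wrt_iff_nth_less)
        then show "f (xs ! k) \<le> f (xs ! l)" "g (xs ! k) \<le> g (xs ! l)"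
          using f(1) g(1) mem[of k] mem[of l] that by (auto simp: monotone_on_def)
      qed
      have "f (xs ! i) = fst (\<pi> ! i) \<and> g (xs ! i) = snd (\<pi> ! i)"
      proof (cases "i \<le> d")
        case True
        have "g (xs ! i) = g (xs ! d)"
          by (rule rk_eqD) (use mono(2)[of i d] mem[of i] mem[of d] g(2) gx[of d] st(1)[of d] corner' i True in \<open>auto simp: mem_Times_iff\<close>)
        moreover have "snd (\<pi> ! i) = snd (\<pi> ! d)"
          by (rule rk_eqD) (use st(1)[of i] st(1)[of d] st(3,4)[of i d] corner' True in \<open>auto simp: mem_Times_iff\<close>)
        ultimately show ?thesis using True fx[of i] gx[of d] by simp
      next
        case False
        have "f (xs ! d) = f (xs ! i)"
          by (rule rk_eqD) (use mono(1)[of d i] mem[of i] mem[of d] f(2) fx[of d] st(1)[of d] corner i False rk_le_d in \<open>auto simp: mem_Times_iff\<close>)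
        moreover have "fst (\<pi> ! d) = fst (\<pi> ! i)"
          by (rule rk_eqD) (use st(1)[of i] st(1)[of d] st(3)[of d i] corner i False rk_le_d in \<open>auto simp: mem_Times_iff\<close>)
        ultimately show ?thesis using i False fx[of d] gx[of i] by simp
      qed
      then show "map fg xs ! i = \<pi> ! i"
        using i len by (simp add: prod_eq_iff)
    qed (use len \<pi>(3) in simp)
    moreover have "map f (take (Suc d) xs) = \<sigma>" "map g (drop d xs) = \<tau>" if "map fg xs = \<pi>"
      by (simp_all add: \<sigma>_def \<tau>_def take_map drop_map flip: that)
    ultimately show ?thesis by (auto simp: \<alpha>_def \<beta>_def)
  qed
  obtain c where c: "\<And>xs. xs \<in> multichains Y' (Suc d) \<Longrightarrow> \<alpha> xs = cobd c xs"
    using acyclic[OF \<alpha>] by blast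
  obtain c' where c': "\<And>xs. xs \<in> multichains Y' (Suc d) \<Longrightarrow> \<beta> xs = cobd c' xs"
    using acyclic[OF \<beta>] by blast
  have slice: "take k xs \<in> multichains Y' (min k l)" "drop k xs \<in> multichains Y' (l - k)"
    if "xs \<in> multichains Y' l" for k l xs
    using that
    by (auto simp: multichains_def sorted_wrt_take sorted_wrt_drop dest: in_set_takeD in_set_dropD)
  show ?thesis
  proof (cases d)
    \<comment> \<open>Here \<open>c\<close> lives on \<open>[]\<close> and shares no vertex with
      \<open>\<beta>\<close>, so the Leibniz rule is replaced by a direct computation with
      constants.\<close>
    case 0
    have "of_bool (map fg xs = \<pi>) = cobd (\<lambda>_. c [] * c' []) xs"
      if xs: "xs \<in> multichains Y' (Suc (2 * d))" for xs
    proof -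
      obtain x where x: "xs = [x]"
        using xs 0 by (auto simp: multichains_def length_Suc_conv)
      have "\<alpha> xs = c []" "\<beta> xs = c' []"
        using c[of xs] c'[of xs] xs 0 by (auto simp: x)
      then show ?thesis
        using cup[OF xs] 0 by (simp add: x)
    qed
    then show ?thesis by blast
  next
    case (Suc k)
    \<comment> \<open>By the Leibniz rule, since \<open>cobd c = \<alpha>\<close> and
      \<open>cobd \<beta> = 0\<close>.\<close>
    have "of_bool (map fg xs = \<pi>) = cobd (cup d c \<beta>) xs"
      if xs: "xs \<in> multichains Y' (Suc (2 * d))" for xs
    proof -
      have "take (Suc d) xs \<in> multichains Y' (Suc d)"
        using slice(1)[OF xs, of "Suc d"] by (simp add: min_def split: if_splits)
      moreover have "drop k xs \<in> multichains Y' (Suc (Suc d))"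
        using slice(2)[OF xs, of k] Suc by (simp add: numeral_3_eq_3)
      then have "cobd \<beta> (drop k xs) = 0"
        using \<beta> multichains_mono[OF Y'] by blast
      moreover have "length xs = Suc (2 * d)"
        using xs by (simp add: multichains_def)
      ultimately show ?thesis
        using cobd_cup[of k xs c \<beta>] cup[OF xs] c Suc by simp
    qed
    then show ?thesis by blast
  qed
qed

text \<open>
  Every other maximal chain has a step in the second coordinate followed by one in the first;
  exchanging the two changes the indicator by a coboundary and moves the chain towards the corner.
\<close>

lemma exists_exchangeable:
  assumes \<pi>: "sorted_wrt (<) \<pi>" "set \<pi> \<subseteq> A \<times> A" "length \<pi> = Suc (2 * d)"
    and "rk (fst (\<pi> ! d)) \<noteq> d"
  shows "\<exists>j. 0 < j \<and> j < 2 * d \<and> rk (fst (\<pi> ! j)) = rk (fst (\<pi> ! (j - 1))) \<and>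
             rk (fst (\<pi> ! (j + 1))) = rk (fst (\<pi> ! j)) + 1"
proof (rule ccontr)
  note st = maximal_chain_staircase[OF \<pi>]
  define u where "u i = rk (fst (\<pi> ! i))" for i
  have u_mono: "u i \<le> u j" if "i \<le> j" "j \<le> 2 * d" for i j
    using st(4)[OF that] by (simp add: u_def)
  have u_step: "u (Suc i) \<le> Suc (u i)" if "i < 2 * d" for i
    using st(2)[of i] st(2)[of "Suc i"] st(4)[of i "Suc i"] that by (auto simp: u_def)
  assume "\<not> ?thesis"
  \<comment> \<open>Without an exchangeable place, a step in the second coordinate is followed only
    by such steps. One occurs by index \<open>d\<close>, so the first level ends below
    \<open>d\<close>, and the second cannot bring the total to \<open>2 * d\<close>.\<close>
  then have flat: "u (j + 1) = u j" if "0 < j" "j < 2 * d" "u j = u (j - 1)" for j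
    using that u_step[of j] u_mono[of j "Suc j"] by (force simp: u_def le_Suc_eq)
  have "u d < d"
    using st(2)[of d] assms(4) by (simp add: u_def)
  have "\<exists>i. 0 < i \<and> i \<le> d \<and> u i = u (i - 1)"
  proof (rule ccontr)
    assume no: "\<not> ?thesis"
    have "i \<le> u i" if "i \<le> d" for i
      using that
    proof (induction i)
      case (Suc i)
      have "u (Suc i) \<noteq> u i" using no Suc.prems by force
      then show ?case
        using Suc u_mono[of i "Suc i"] by simp
    qed simp
    then show False using \<open>u d < d\<close> by force
  qed
  then obtain i where i: "0 < i" "i \<le> d" "u i = u (i - 1)" by blast
  have "u (i + k) = u i \<and> u (i + k) = u (i + k - 1)" if "i + k \<le> 2 * d" for k
    using that
  proof (induction k)
    case (Suc k)
    then show ?case using flat[of "i + k"] i by simp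
  qed (use i in simp)
  from this[of "2 * d - i"] have "u (2 * d) = u i"
    using i by simp
  then have "u (2 * d) < d"
    using u_mono[of i d] i \<open>u d < d\<close> by simp
  moreover have "rk (snd (\<pi> ! (2 * d))) \<le> d"
    using st(1)[of "2 * d"] by (auto intro!: rk_le_d simp: mem_Times_iff)
  ultimately show False
    using st(2)[of "2 * d"] by (simp add: u_def)
qed

text \<open>An exchange raises the sum of the first levels, which is at most
  \<open>Suc (2 * d) * d\<close>; hence the induction measure decreases until the corner is
  reached.\<close>

proposition indicator_coboundary:
  assumes "sorted_wrt (<) \<pi>" "set \<pi> \<subseteq> A \<times> A" "length \<pi> = Suc (2 * d)"
  shows "\<exists>c. \<forall>xs\<in>multichains Y' (Suc (2 * d)). of_bool (map fg xs = \<pi>) = cobd c xs"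
  using assms
proof (induction "Suc (2 * d) * d - (\<Sum>i<Suc (2 * d). rk (fst (\<pi> ! i)))" arbitrary: \<pi> rule: less_induct)
  case less
  note \<pi> = less.prems
  note st = maximal_chain_staircase[OF \<pi>]
  show ?case
  proof (cases "rk (fst (\<pi> ! d)) = d")
    case True
    then show ?thesis by (rule indicator_coboundary_corner[OF \<pi>])
  next
    case False
    obtain j where j: "0 < j" "j < 2 * d" "rk (fst (\<pi> ! j)) = rk (fst (\<pi> ! (j - 1)))"
      "rk (fst (\<pi> ! (j + 1))) = rk (fst (\<pi> ! j)) + 1"
      using exists_exchangeable[OF \<pi> False] by blast
    obtain p q where pq: "\<pi> ! (j - 1) = (p, q)" by fastforce
    obtain p' q' where pq': "\<pi> ! (j + 1) = (p', q')" by fastforce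
    have mem: "p \<in> A" "q \<in> A" "p' \<in> A" "q' \<in> A"
      using st(1)[of "j - 1"] st(1)[of "j + 1"] j pq pq' by auto
    \<comment> \<open>A coordinate whose level does not change does not change itself.\<close>
    have \<pi>j: "\<pi> ! j = (p, q')"
    proof -
      have "p = fst (\<pi> ! j)"
        by (rule rk_eqD) (use st(1)[of j] st(3)[of "j - 1" j] j pq mem in \<open>auto simp: mem_Times_iff\<close>)
      moreover have "snd (\<pi> ! j) = q'"
        by (rule rk_eqD)
          (use st(1)[of j] st(2)[of j] st(2)[of "j + 1"] st(3)[of j "j + 1"] j pq' mem in \<open>auto simp: mem_Times_iff\<close>)
      ultimately show ?thesis by (simp add: prod_eq_iff)
    qed
    have "rk p + rk q = j - 1" "rk p + rk q' = j"
      using st(2)[of "j - 1"] st(2)[of j] j(2) pq \<pi>j by simp_all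
    then have rks: "rk p' = rk p + 1" "rk q' = rk q + 1"
      using j(1,4) pq' \<pi>j by simp_all
    have le: "p \<le> p'" "q \<le> q'"
      using st(3)[of "j - 1" "j + 1"] j pq pq' by auto
    then have lt: "p < p'" "q < q'"
      using rks by (auto simp: order_less_le)
    \<comment> \<open>The corner opposite to \<open>\<pi> ! j\<close> in the square from
      \<open>(p, q)\<close> to \<open>(p', q')\<close>.\<close>
    let ?t = "(p', q)"
    have between: "\<pi> ! (j - 1) < ?t" "?t < \<pi> ! (j + 1)"
      unfolding pq pq' using lt by (auto simp: less_prod_def less_eq_prod_def)
    have strict: "sorted_wrt (<) (\<pi>[j := ?t])"
      unfolding sorted_wrt_iff_nth_less
    proof (intro allI impI)
      fix a b assume ab: "a < b" "b < length (\<pi>[j := ?t])"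
      have lt: "\<pi> ! a < \<pi> ! b" if "a < b" "b < Suc (2 * d)" for a b
        using \<pi> that by (simp add: sorted_wrt_iff_nth_less)
      have "\<pi> ! a < ?t" if "b = j"
      proof (cases "a = j - 1")
        case False
        then have "\<pi> ! a < \<pi> ! (j - 1)" using ab that j by (intro lt) auto
        then show ?thesis using between(1) by (rule less_trans)
      qed (use between in simp)
      moreover have "?t < \<pi> ! b" if "a = j"
      proof (cases "b = j + 1")
        case False
        then have "\<pi> ! (j + 1) < \<pi> ! b" using ab that j \<pi>(3) by (intro lt) auto
        with between(2) show ?thesis by (rule less_trans)
      qed (use between in simp)
      ultimately show "\<pi>[j := ?t] ! a < \<pi>[j := ?t] ! b"
        using ab lt[of a b] \<pi>(3) j(2) by (auto simp: nth_list_update)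
    qed
    have "?t \<noteq> \<pi> ! j"
      using lt by (auto simp: \<pi>j)
    \<comment> \<open>Each side of the square spans a single level, so only its four corners
      remain.\<close>
    have two: "y = \<pi> ! j \<or> y = ?t"
      if "y \<in> A \<times> A" "\<pi> ! (j - 1) < y" "y < \<pi> ! (j + 1)" for y
    proof -
      obtain a b where y: "y = (a, b)" by fastforce
      have ab: "p \<le> a" "a \<le> p'" "q \<le> b" "b \<le> q'" "a \<in> A" "b \<in> A"
        using that unfolding y pq pq' by (auto simp: less_prod_def less_eq_prod_def)
      have "a = p \<or> a = p'" "b = q \<or> b = q'"
        using rk_eqD[of p a] rk_eqD[of a p'] rk_eqD[of q b] rk_eqD[of b q'] ab mem rks by force+
      then show ?thesis
        using that(2,3) unfolding y pq pq' \<pi>j by auto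
    qed
    have "(\<Sum>i<Suc (2 * d). rk (fst (\<pi> ! i))) < (\<Sum>i<Suc (2 * d). rk (fst (\<pi>[j := ?t] ! i)))"
    proof (rule sum_strict_mono_ex1)
      show "\<forall>i\<in>{..<Suc (2 * d)}. rk (fst (\<pi> ! i)) \<le> rk (fst (\<pi>[j := ?t] ! i))"
        using \<pi>(3) j(2) by (auto simp: nth_list_update \<pi>j rks)
      show "\<exists>i\<in>{..<Suc (2 * d)}. rk (fst (\<pi> ! i)) < rk (fst (\<pi>[j := ?t] ! i))"
        using \<pi>(3) j by (intro bexI[of _ j]) (auto simp: \<pi>j rks)
    qed simp
    moreover have sub: "set (\<pi>[j := ?t]) \<subseteq> A \<times> A"
      using \<pi>(2) mem set_update_subset_insert[of \<pi> j ?t] by auto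
    have "(\<Sum>i<Suc (2 * d). rk (fst (\<pi>[j := ?t] ! i))) \<le> (\<Sum>i<Suc (2 * d). d)"
    proof (rule sum_mono)
      fix i assume "i \<in> {..<Suc (2 * d)}"
      then have "\<pi>[j := ?t] ! i \<in> A \<times> A"
        using sub \<pi>(3) by (metis length_list_update lessThan_iff nth_mem subsetD)
      then show "rk (fst (\<pi>[j := ?t] ! i)) \<le> d"
        by (auto intro!: rk_le_d simp: mem_Times_iff)
    qed
    ultimately have dec: "Suc (2 * d) * d - (\<Sum>i<Suc (2 * d). rk (fst (\<pi>[j := ?t] ! i))) <
        Suc (2 * d) * d - (\<Sum>i<Suc (2 * d). rk (fst (\<pi> ! i)))"
      by (simp only: sum_constant card_lessThan of_nat_id)
    obtain c where c: "\<And>xs. xs \<in> multichains Y' (Suc (2 * d)) \<Longrightarrow>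
        of_bool (map fg xs = \<pi>[j := ?t]) = cobd c xs"
      using less.hyps[OF dec strict sub] \<pi>(3) by auto
    let ?w = "\<lambda>zs. of_bool (zs = take j \<pi> @ drop (Suc j) \<pi>) :: bit"
    have "of_bool (map fg xs = \<pi>) = cobd (\<lambda>ys. c ys + ?w (map fg ys)) xs"
      if xs: "xs \<in> multichains Y' (Suc (2 * d))" for xs
    proof -
      have "of_bool (map fg xs = \<pi>) + of_bool (map fg xs = \<pi>[j := ?t]) = cobd ?w (map fg xs)"
        using \<pi> j(1,2) strict \<open>?t \<noteq> \<pi> ! j\<close> two map_fg_mem[OF xs]
        by (rule ranked.indicator_swap[OF ranked_Times])
      then show ?thesis
        unfolding cobd_add cobd_map[of ?w fg] c[OF xs, symmetric]
        by (simp add: bit_add_eq_iff add.commute)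
    qed
    then show ?thesis by blast
  qed
qed

end

subsection \<open>Samples of small sets\<close>

text \<open>For large \<open>e\<close> both conditions may hold and the first one wins; on small
  sets they will turn out to exclude each other.\<close>

definition set_sample :: "'a::euclidean_space set set \<Rightarrow> 'a set \<Rightarrow> 'a sample" where
  "set_sample \<F> e = (\<lambda>A.
     if A \<in> \<F> \<and> e \<inter> A \<noteq> {} then Some 1
     else if A \<in> \<F> \<and> e \<inter> uminus ` A \<noteq> {} then Some (-1)
     else None)"

lemma set_sample_pos: "A \<in> \<F> \<Longrightarrow> e \<inter> A \<noteq> {} \<Longrightarrow> set_sample \<F> e A = Some 1"
  by (simp add: set_sample_def)

lemma set_sample_neg:
  "A \<in> \<F> \<Longrightarrow> e \<inter> A = {} \<Longrightarrow> e \<inter> uminus ` A \<noteq> {} \<Longrightarrow> set_sample \<F> e A = Some (-1)"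
  by (simp add: set_sample_def)

lemma dom_set_sample: "dom (set_sample \<F> e) = {A \<in> \<F>. e \<inter> A \<noteq> {} \<or> e \<inter> uminus ` A \<noteq> {}}"
  by (auto simp: set_sample_def dom_def)

lemma set_sample_singleton: "set_sample \<F> {u} = point_sample \<F> u"
  by (auto simp: set_sample_def point_sample_def fun_eq_iff)

lemma finite_samples: "finite \<F> \<Longrightarrow> finite (samples \<F>)"
proof -
  assume "finite \<F>"
  have "samples \<F> \<subseteq> (\<Union>D\<in>Pow \<F>. {s. dom s = D \<and> ran s \<subseteq> {-1, 1}})"
    by (auto simp: samples_def)
  moreover have "finite (\<Union>D\<in>Pow \<F>. {s. dom s = D \<and> ran s \<subseteq> {-1, 1::int}})"
    using \<open>finite \<F>\<close> finite_subset by (intro finite_UN_I finite_set_of_finite_maps) auto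
  ultimately show ?thesis by (rule finite_subset)
qed

text \<open>\<open>W v\<close> removes the finitely many closed sets that miss \<open>v\<close>, so
  \<open>v\<close> lies in every member or antipode met by a subset of \<open>W v\<close>. A
  Lebesgue number of this open cover gives the scale.\<close>

lemma sphere_cover_common_point:
  fixes \<F> :: "'a::euclidean_space set set"
  assumes "sphere_cover n \<F>"
  obtains \<delta> where "\<delta> > 0"
    "\<And>e. e \<in> small (sphere 0 1) \<delta> \<Longrightarrow>
       \<exists>v\<in>sphere 0 1. \<forall>A\<in>\<F>. (e \<inter> A \<noteq> {} \<longrightarrow> v \<in> A) \<and> (e \<inter> uminus ` A \<noteq> {} \<longrightarrow> v \<in> uminus ` A)"
proof -
  let ?S = "sphere (0::'a) 1"
  define \<C> where "\<C> = \<F> \<union> image uminus ` \<F>"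
  define W where "W v = - \<Union>{C \<in> \<C>. v \<notin> C}" for v
  have "finite \<C>"
    using assms by (simp add: \<C>_def sphere_cover_def)
  have "closed A" if "A \<in> \<F>" for A
    using assms that closedin_closed_trans[of ?S A] by (auto simp: sphere_cover_def)
  then have "closed C" if "C \<in> \<C>" for C
    using that closed_negations by (auto simp: \<C>_def)
  then have "open (W v)" for v
    using \<open>finite \<C>\<close> by (auto simp: W_def intro!: open_Compl closed_Union)
  moreover have "v \<in> W v" for v
    by (auto simp: W_def)
  moreover have "?S \<noteq> {}" by simp
  ultimately obtain \<delta> where \<delta>: "0 < \<delta>"
    "\<And>T. T \<subseteq> ?S \<Longrightarrow> diameter T < \<delta> \<Longrightarrow> \<exists>B \<in> W ` ?S. T \<subseteq> B"
    by (rule_tac Lebesgue_number_lemma[of ?S "W ` ?S"]) (auto simp del: sphere_eq_empty)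
  show thesis
  \<comment> \<open>Halving turns the weak bound in \<open>small\<close> into the strict one on the
    diameter.\<close>
  proof (rule that[of "\<delta> / 2"])
    show "\<delta> / 2 > 0" using \<delta>(1) by simp
    fix e assume e: "e \<in> small ?S (\<delta> / 2)"
    have "diameter e \<le> \<delta> / 2"
      by (rule diameter_le) (use e \<delta>(1) smallD[OF e] in \<open>auto simp: small_def dist_norm\<close>)
    then have "diameter e < \<delta>" using \<delta>(1) by simp
    moreover have "e \<subseteq> ?S" using e by (simp add: small_def)
    ultimately obtain v where v: "v \<in> ?S" "e \<subseteq> W v"
      using \<delta>(2) by blast
    have C: "v \<in> C" if "C \<in> \<C>" "e \<inter> C \<noteq> {}" for C
      using that v by (auto simp: W_def)
    show "\<exists>v\<in>?S. \<forall>A\<in>\<F>. (e \<inter> A \<noteq> {} \<longrightarrow> v \<in> A) \<and> (e \<inter> uminus ` A \<noteq> {} \<longrightarrow> v \<in> uminus ` A)"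
      by (intro bexI[OF _ v(1)] ballI conjI impI C) (auto simp: \<C>_def)
  qed
qed

text \<open>The sample of a small set \<open>e\<close> lies between that of a point of
  \<open>e\<close> and that of the common point \<open>v\<close>, hence in \<open>H_int\<close>. Its
  image under \<open>\<rho>\<close> is \<open>r e\<close>; finitely many samples give finitely many
  values.\<close>

lemma small_set_map:
  fixes \<rho> :: "'a::euclidean_space sample \<Rightarrow> 'p::order"
  assumes cover: "sphere_cover n \<F>" and mono: "monotone_on (H_int \<F>) (\<subseteq>\<^sub>m) (\<le>) \<rho>"
    and free: "\<forall>s\<in>H_int \<F>. \<rho> s \<noteq> \<rho> (antipode s)"
  obtains \<delta> and r :: "'a set \<Rightarrow> 'p" where "\<delta> > 0" "monotone_on (small (sphere 0 1) \<delta>) (\<le>) (\<le>) r"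
    "\<And>e. e \<in> small (sphere 0 1) \<delta> \<Longrightarrow> r (uminus ` e) \<noteq> r e"
    "\<And>e. e \<in> small (sphere 0 1) \<delta> \<Longrightarrow> \<exists>u\<in>sphere 0 1. r e \<le> \<rho> (point_sample \<F> u)"
    "finite (r ` small (sphere 0 1) \<delta>)"
proof -
  let ?S = "sphere (0::'a) 1"
  obtain \<delta> where \<delta>: "\<delta> > 0"
    "\<And>e. e \<in> small ?S \<delta> \<Longrightarrow>
       \<exists>v\<in>?S. \<forall>A\<in>\<F>. (e \<inter> A \<noteq> {} \<longrightarrow> v \<in> A) \<and> (e \<inter> uminus ` A \<noteq> {} \<longrightarrow> v \<in> uminus ` A)"
    using sphere_cover_common_point[OF cover] by blast
  have free': "A \<inter> uminus ` A = {}" if "A \<in> \<F>" for A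
    using cover that by (auto simp: sphere_cover_def antipodal_free_def)
  have union: "\<Union>\<F> = ?S"
    using cover by (simp add: sphere_cover_def)
  \<comment> \<open>Otherwise the common point would lie in \<open>A\<close> and in its
    antipode.\<close>
  have excl: "e \<inter> uminus ` A = {}" if "e \<in> small ?S \<delta>" "A \<in> \<F>" "e \<inter> A \<noteq> {}" for e A
    using \<delta>(2)[OF that(1)] that(2,3) free'[OF that(2)] by blast
  have sample_mono: "set_sample \<F> e \<subseteq>\<^sub>m set_sample \<F> e'" if "e \<subseteq> e'" "e' \<in> small ?S \<delta>" for e e'
    unfolding map_le_def
  proof
    fix A assume "A \<in> dom (set_sample \<F> e)"
    then have A: "A \<in> \<F>" "e \<inter> A \<noteq> {} \<or> e \<inter> uminus ` A \<noteq> {}"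
      by (simp_all add: dom_set_sample)
    show "set_sample \<F> e A = set_sample \<F> e' A"
    proof (cases "e \<inter> A = {}")
      case False
      then have "e' \<inter> A \<noteq> {}" using that(1) by blast
      then show ?thesis using False A(1) by (simp add: set_sample_pos)
    next
      case True
      then have "e' \<inter> uminus ` A \<noteq> {}" using A(2) that(1) by blast
      moreover from this have "e' \<inter> A = {}" using excl[OF that(2) A(1)] by blast
      ultimately show ?thesis using True A by (simp add: set_sample_neg)
    qed
  qed
  have sample_le: "\<exists>v\<in>?S. set_sample \<F> e \<subseteq>\<^sub>m point_sample \<F> v" if e: "e \<in> small ?S \<delta>" for e
  proof -
    obtain v where v: "v \<in> ?S"
      "\<forall>A\<in>\<F>. (e \<inter> A \<noteq> {} \<longrightarrow> v \<in> A) \<and> (e \<inter> uminus ` A \<noteq> {} \<longrightarrow> v \<in> uminus ` A)"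
      using \<delta>(2)[OF e] by blast
    have "set_sample \<F> e A = point_sample \<F> v A" if A: "A \<in> dom (set_sample \<F> e)" for A
    proof -
      have A: "A \<in> \<F>" "e \<inter> A \<noteq> {} \<or> e \<inter> uminus ` A \<noteq> {}"
        using A by (simp_all add: dom_set_sample)
      show ?thesis
      proof (cases "e \<inter> A = {}")
        case False
        then have "v \<in> A" using v(2) A(1) by blast
        then show ?thesis using False A(1) by (simp add: set_sample_pos point_sample_def)
      next
        case True
        then have "v \<in> uminus ` A" using v(2) A by blast
        moreover from this have "v \<notin> A" using free'[OF A(1)] by blast
        ultimately show ?thesis using True A by (simp add: set_sample_neg point_sample_def)
      qed
    qed
    then show ?thesis using v(1) by (auto simp: map_le_def)
  qed
  have sing: "{u} \<in> small ?S \<delta>" if "u \<in> ?S" for u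
    using that \<delta>(1) by (simp add: small_def)
  have H_int: "set_sample \<F> e \<in> H_int \<F>" if e: "e \<in> small ?S \<delta>" for e
  proof -
    have "e \<noteq> {}" "e \<subseteq> ?S" using e by (simp_all add: small_def)
    then obtain u where u: "u \<in> e" "u \<in> ?S" by blast
    then obtain A where "A \<in> \<F>" "u \<in> A" using union by blast
    then have "set_sample \<F> e A = Some 1"
      using u by (intro set_sample_pos) auto
    then have "set_sample \<F> e \<noteq> Map.empty" by auto
    moreover have "ran (set_sample \<F> e) \<subseteq> {-1, 1}"
      by (auto simp: ran_def set_sample_def split: if_splits)
    ultimately have "set_sample \<F> e \<in> samples \<F>"
      by (simp add: samples_def dom_set_sample)
    moreover have "point_sample \<F> u \<subseteq>\<^sub>m set_sample \<F> e"
      using sample_mono[of "{u}" e] u e by (simp add: set_sample_singleton)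
    ultimately show ?thesis
      using sample_le[OF e] u(2) unfolding H_int_def H_ex_def by blast
  qed
  have antipode: "set_sample \<F> (uminus ` e) = antipode (set_sample \<F> e)" if e: "e \<in> small ?S \<delta>" for e
  proof
    fix A
    have neg: "uminus ` X \<inter> Y = {} \<longleftrightarrow> X \<inter> uminus ` Y = {}" for X Y :: "'a set"
      by (force simp: disjoint_iff)
    have "uminus ` e \<inter> uminus ` A = {} \<longleftrightarrow> e \<inter> A = {}"
      using neg[of e "uminus ` A"] by (simp add: image_image)
    with neg[of e A] show "set_sample \<F> (uminus ` e) A = antipode (set_sample \<F> e) A"
      using excl[OF e, of A] by (auto simp: set_sample_def antipode_def)
  qed
  define r where "r e = \<rho> (set_sample \<F> e)" for e
  show thesis
  proof (rule that[OF \<delta>(1), of r])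
    show "monotone_on (small ?S \<delta>) (\<le>) (\<le>) r"
      using mono H_int sample_mono unfolding monotone_on_def r_def by blast
    show "r (uminus ` e) \<noteq> r e" if "e \<in> small ?S \<delta>" for e
      using free H_int[OF that] antipode[OF that] unfolding r_def by force
    show "\<exists>u\<in>?S. r e \<le> \<rho> (point_sample \<F> u)" if e: "e \<in> small ?S \<delta>" for e
    proof -
      obtain v where v: "v \<in> ?S" "set_sample \<F> e \<subseteq>\<^sub>m point_sample \<F> v"
        using sample_le[OF e] by blast
      moreover have "point_sample \<F> v \<in> H_int \<F>"
        using H_int[OF sing[OF v(1)]] by (simp add: set_sample_singleton)
      ultimately have "r e \<le> \<rho> (point_sample \<F> v)"
        using mono H_int[OF e] unfolding monotone_on_def r_def by blast
      then show ?thesis using v(1) by blast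
    qed
    have "r ` small ?S \<delta> \<subseteq> \<rho> ` samples \<F>"
      using H_int by (auto simp: r_def H_int_def)
    moreover have "finite (samples \<F>)"
      using cover by (simp add: finite_samples sphere_cover_def)
    ultimately show "finite (r ` small ?S \<delta>)"
      by (meson finite_imageI finite_subset)
  qed
qed

subsection \<open>Ranks\<close>

lemma strict_le_last:
  "sorted_wrt (<) xs \<Longrightarrow> x \<in> set xs \<Longrightarrow> x \<le> last (xs :: 'p::order list)"
  by (induction xs rule: rev_induct) (auto simp: sorted_wrt_append intro: less_imp_le)

lemma chain_length_le_poset_rank:
  assumes "xs \<noteq> []" "sorted_wrt (<) xs" "last xs = p"
  shows "enat (length xs - 1) \<le> poset_rank p"
  unfolding poset_rank_def by (rule Sup_upper) (use assms in blast)

lemma poset_rank_mono: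
  assumes "p \<le> q"
  shows "poset_rank p \<le> poset_rank q"
proof (cases "p = q")
  case False
  then have "p < q" using assms by simp
  have "enat (length xs - 1) \<le> poset_rank q"
    if xs: "xs \<noteq> []" "sorted_wrt (<) xs" "last xs = p" for xs
  proof -
    have "\<forall>x\<in>set xs. x < q"
      using strict_le_last[OF xs(2)] xs(3) \<open>p < q\<close> by (auto intro: le_less_trans)
    then have "sorted_wrt (<) (xs @ [q])"
      using xs(2) by (simp add: sorted_wrt_append)
    then have "enat (length (xs @ [q]) - 1) \<le> poset_rank q"
      by (intro chain_length_le_poset_rank) auto
    moreover have "enat (length xs - 1) \<le> enat (length (xs @ [q]) - 1)"
      by simp
    ultimately show ?thesis by (rule order_trans[rotated])
  qed
  then show ?thesis
    unfolding poset_rank_def[of p] by (intro Sup_least) blast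
qed simp

text \<open>The level is the maximal chain length in the whole type, finite by the bound; appending
  \<open>y\<close> to a longest chain ending at \<open>x\<close> makes it strictly
  increasing.\<close>

lemma ranked_if_poset_rank_le:
  assumes "\<And>p. p \<in> A \<Longrightarrow> poset_rank p \<le> enat d"
  shows "\<exists>rk. ranked A rk d"
proof -
  define R where "R p k \<longleftrightarrow> (\<exists>xs. length xs = Suc k \<and> sorted_wrt (<) xs \<and> last xs = p)" for p :: 'a and k
  define rk where "rk p = (GREATEST k. R p k)" for p
  have bound: "k \<le> d" if Rpk: "R p k" and p: "p \<in> A" for p k
  proof -
    obtain xs where xs: "length xs = Suc k" "sorted_wrt (<) xs" "last xs = p"
      using Rpk unfolding R_def by blast
    then have "enat (length xs - 1) \<le> poset_rank p"
      by (intro chain_length_le_poset_rank) auto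
    then have "enat k \<le> poset_rank p"
      using xs(1) by simp
    from order_trans[OF this assms[OF p]] show ?thesis by simp
  qed
  have R0: "R p 0" for p
    unfolding R_def by (rule exI[of _ "[p]"]) simp
  have R_rk: "R p (rk p)" if "p \<in> A" for p
    unfolding rk_def using R0 bound[OF _ that] by (rule GreatestI_nat)
  have rk_max: "k \<le> rk p" if "R p k" "p \<in> A" for p k
    unfolding rk_def using that(1) bound[OF _ that(2)] by (rule Greatest_le_nat)
  have "ranked A rk d"
  proof
    fix x y assume xy: "x \<in> A" "y \<in> A" "x < y"
    obtain xs where xs: "length xs = Suc (rk x)" "sorted_wrt (<) xs" "last xs = x"
      using R_rk[OF xy(1)] unfolding R_def by blast
    have "\<forall>z\<in>set xs. z < y"
      using strict_le_last[OF xs(2)] xs(3) xy(3) by (auto intro: le_less_trans)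
    then have "sorted_wrt (<) (xs @ [y])"
      using xs(2) by (simp add: sorted_wrt_append)
    then have "R y (Suc (rk x))"
      unfolding R_def using xs(1) by (intro exI[of _ "xs @ [y]"]) simp
    then show "rk x < rk y"
      using rk_max xy(2) by force
  qed (use R_rk bound in blast)
  then show ?thesis by blast
qed

text \<open>Witnessed by the positive elements of smaller absolute value, followed by
  \<open>q\<close>.\<close>

lemma poset_rank_H2inf_ge: "enat (nat (\<bar>Rep_H2inf q\<bar> - 2)) \<le> poset_rank q"
proof -
  define m where "m = nat \<bar>Rep_H2inf q\<bar>"
  let ?xs = "map (\<lambda>i. Abs_H2inf (int i)) [2..<m] @ [q]"
  have "m \<ge> 2"
    using Rep_H2inf[of q] by (simp add: m_def)
  have rep: "Rep_H2inf (Abs_H2inf (int i)) = int i" if "i \<ge> 2" for i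
    using that by (intro Abs_H2inf_inverse) simp
  have "sorted_wrt (\<lambda>i j. Abs_H2inf (int i) < Abs_H2inf (int j)) [2..<m]"
    by (rule sorted_wrt_mono_rel[OF _ sorted_wrt_upt]) (simp add: less_H2inf_def rep)
  then have "sorted_wrt (<) ?xs"
    by (auto simp: sorted_wrt_append sorted_wrt_map less_H2inf_def rep m_def)
  then have "enat (length ?xs - 1) \<le> poset_rank q"
    by (intro chain_length_le_poset_rank) auto
  moreover have "length ?xs - 1 = nat (\<bar>Rep_H2inf q\<bar> - 2)"
    by (auto simp: m_def)
  ultimately show ?thesis by simp
qed

subsection \<open>Lower bounds for the rank\<close>

lemma rank_lower_bound:
  fixes \<F> :: "'a::euclidean_space set set" and \<rho> :: "'a sample \<Rightarrow> 'p::order"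
  assumes "sphere_cover n \<F>" "n \<ge> 1" "monotone_on (H_int \<F>) (\<subseteq>\<^sub>m) (\<le>) \<rho>"
    "\<forall>s\<in>H_int \<F>. \<rho> s \<noteq> \<rho> (antipode s)"
  shows "\<exists>u\<in>sphere 0 1. \<not> poset_rank (\<rho> (point_sample \<F> u)) \<le> enat (n div 2)"
proof (rule ccontr)
  let ?S = "sphere (0::'a) 1"
  define d where "d = n div 2"
  assume "\<not> ?thesis"
  then have low: "poset_rank (\<rho> (point_sample \<F> u)) \<le> enat d" if "u \<in> ?S" for u
    using that by (auto simp: d_def)
  obtain \<delta> r where "\<delta> > 0" and mono: "monotone_on (small ?S \<delta>) (\<le>) (\<le>) r"
    and free: "\<And>e. e \<in> small ?S \<delta> \<Longrightarrow> r (uminus ` e) \<noteq> r e"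
    and le: "\<And>e. e \<in> small ?S \<delta> \<Longrightarrow> \<exists>u\<in>?S. r e \<le> \<rho> (point_sample \<F> u)"
    and fin: "finite (r ` small ?S \<delta>)"
    using small_set_map[OF assms(1,3,4)] by blast
  define A where "A = r ` small ?S \<delta>"
  have "poset_rank p \<le> enat d" if "p \<in> A" for p
  proof -
    obtain e where e: "e \<in> small ?S \<delta>" "p = r e" using \<open>p \<in> A\<close> by (auto simp: A_def)
    then obtain u where "u \<in> ?S" "p \<le> \<rho> (point_sample \<F> u)" using le by blast
    then show ?thesis using low poset_rank_mono order_trans by blast
  qed
  then obtain rk where rk: "ranked A rk d"
    using ranked_if_poset_rank_le by blast
  have dim: "DIM('a) = n + 1"
    using assms(1) by (simp add: sphere_cover_def)
  \<comment> \<open>Here \<open>n \<ge> 1\<close> enters: it gives \<open>d < n\<close>, so the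
    sphere is acyclic in the degree \<open>d\<close> of the cocycles.\<close>
  have "Suc d < DIM('a)"
    using dim \<open>n \<ge> 1\<close> by (simp add: d_def)
  then have "acyclic_at ?S (Suc d)"
    using subsphere_acyclic_at[of "Basis :: 'a set" "Suc d"] by (simp add: subsphere_Basis)
  then obtain \<epsilon> where \<epsilon>: "\<epsilon> > 0"
    "\<And>a. \<forall>zs\<in>multichains (small ?S \<delta>) (Suc (Suc d)). cobd a zs = 0 \<Longrightarrow>
       \<exists>c. \<forall>xs\<in>multichains (small ?S \<epsilon>) (Suc d). a xs = cobd c xs"
    using \<open>\<delta> > 0\<close> unfolding acyclic_at_def by blast
  define q where "q = min \<delta> \<epsilon>"
  have q: "q > 0" "small ?S q \<subseteq> small ?S \<delta>" "small ?S q \<subseteq> small ?S \<epsilon>"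
    using \<open>\<delta> > 0\<close> \<epsilon>(1) unfolding q_def by (simp_all add: small_mono)
  have um: "monotone_on (small ?S \<delta>) (\<le>) (\<le>) (\<lambda>e. r (uminus ` e))"
  proof (rule monotone_onI)
    fix e e' assume e: "e \<in> small ?S \<delta>" "e' \<in> small ?S \<delta>" "e \<subseteq> e'"
    show "r (uminus ` e) \<le> r (uminus ` e')"
      by (rule monotone_onD[OF mono]) (use e uminus_image_small in \<open>blast+\<close>)
  qed
  interpret ranked A rk d by (fact rk)
  interpret ranked_pair A rk d "small ?S \<delta>" "small ?S q" r "\<lambda>e. r (uminus ` e)"
  proof
    show "\<exists>c. \<forall>xs\<in>multichains (small ?S q) (Suc d). a xs = cobd c xs"
      if "\<forall>zs\<in>multichains (small ?S \<delta>) (Suc (Suc d)). cobd a zs = 0" for a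
      using \<epsilon>(2)[OF that] multichains_mono[OF q(3)] by blast
  qed (use mono um uminus_image_small q in \<open>auto simp: A_def\<close>)
  \<comment> \<open>The choice is made from the unordered pair, so swapping \<open>x\<close> and
    \<open>y\<close> does not affect it and \<open>h\<close> is antisymmetric.\<close>
  define h where "h = (\<lambda>(x, y). x = (SOME z. z \<in> {x, y :: 'p}))"
  have h: "h (y, x) \<longleftrightarrow> \<not> h (x, y)" if "x \<noteq> y" for x y
  proof -
    define c where "c = (SOME z. z \<in> {x, y})"
    have "c \<in> {x, y}" unfolding c_def by (rule someI[of _ x]) simp
    moreover have "h (x, y) \<longleftrightarrow> x = c" "h (y, x) \<longleftrightarrow> y = c"
      by (simp_all only: h_def case_prod_conv c_def insert_commute[of y x])
    ultimately show ?thesis using that by auto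
  qed
  \<comment> \<open>On multichains of this length, being alternating is the disjoint union of the
    events \<open>map fg xs = \<pi>\<close> for \<open>\<pi>\<close> in the finite set
    \<open>M\<close>.\<close>
  define M where "M = {\<pi>. set \<pi> \<subseteq> A \<times> A \<and> length \<pi> = Suc (2 * d) \<and> sorted_wrt (<) \<pi> \<and> alternating h True \<pi>}"
  have "finite M"
    by (rule finite_subset[OF _ finite_lists_length_eq[of "A \<times> A" "Suc (2 * d)"]])
      (use fin in \<open>auto simp: M_def A_def\<close>)
  have "\<forall>\<pi>\<in>M. \<exists>c. \<forall>xs\<in>multichains (small ?S q) (Suc (2 * d)). of_bool (map fg xs = \<pi>) = cobd c xs"
    using indicator_coboundary by (simp add: M_def)
  from bchoice[OF this] obtain c where c: "\<And>\<pi> xs. \<pi> \<in> M \<Longrightarrow>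
      xs \<in> multichains (small ?S q) (Suc (2 * d)) \<Longrightarrow> of_bool (map fg xs = \<pi>) = cobd (c \<pi>) xs"
    by blast
  show False
  proof (rule alternating_not_coboundary[where h = "h \<circ> fg"])
    show "2 * d < DIM('a)" using dim by (simp add: d_def)
    show "q > 0" by (fact q(1))
    show "(h \<circ> fg) (uminus ` e) \<longleftrightarrow> \<not> (h \<circ> fg) e" if "e \<in> small ?S q" for e
    proof -
      have "e \<in> small ?S \<delta>" using that q(2) by blast
      then have "r e \<noteq> r (uminus ` e)" using free by metis
      from h[OF this] show ?thesis by (simp add: image_image)
    qed
    fix xs assume xs: "xs \<in> multichains (small ?S q) (Suc (2 * d))"
    have m: "map fg xs \<in> multichains (A \<times> A) (Suc (2 * d))"
      by (rule map_fg_mem[OF xs])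
    then have "alternating h True (map fg xs) \<longleftrightarrow> map fg xs \<in> M"
      using alternating_strict[of h True "map fg xs"] by (auto simp: M_def multichains_def)
    moreover have "of_bool (map fg xs \<in> M) = (\<Sum>\<pi>\<in>M. of_bool (map fg xs = \<pi>) :: bit)"
      using \<open>finite M\<close> by (simp add: of_bool_def)
    ultimately show "of_bool (alternating (h \<circ> fg) True xs) = cobd (\<lambda>ys. \<Sum>\<pi>\<in>M. c \<pi> ys) xs"
      using c xs by (simp add: cobd_sum flip: alternating_map)
  qed
qed

text \<open>A tie in absolute value with \<open>a \<noteq> b\<close> means \<open>a = - b\<close>,
  so both branches of \<open>m\<close> agree. Away from ties the smaller absolute value decides, and
  it cannot decrease.\<close>

lemma abs_min_mono:
  fixes a b a' b' :: int
  assumes "a = a' \<or> \<bar>a\<bar> < \<bar>a'\<bar>" "b = b' \<or> \<bar>b\<bar> < \<bar>b'\<bar>" "a \<noteq> b" "a' \<noteq> b'"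
  defines "m \<equiv> \<lambda>a b. if \<bar>a\<bar> \<le> \<bar>b\<bar> then a else - b"
  shows "m a b = m a' b' \<or> \<bar>m a b\<bar> < \<bar>m a' b'\<bar>"
  unfolding m_def using assms(1-4) by (smt (verit))

lemma rank_H2inf_lower_bound:
  fixes \<F> :: "'a::euclidean_space set set" and \<rho> :: "'a sample \<Rightarrow> H2inf"
  assumes "sphere_cover n \<F>" "monotone_on (H_int \<F>) (\<subseteq>\<^sub>m) (\<le>) \<rho>"
    "\<forall>s\<in>H_int \<F>. \<rho> s \<noteq> \<rho> (antipode s)"
  shows "\<exists>u\<in>sphere 0 1. poset_rank (\<rho> (point_sample \<F> u)) \<ge> enat n"
proof (rule ccontr)
  let ?S = "sphere (0::'a) 1"
  assume "\<not> ?thesis"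
  then have low: "poset_rank (\<rho> (point_sample \<F> u)) < enat n" if "u \<in> ?S" for u
    using that by (auto simp: not_le)
  obtain \<delta> r where "\<delta> > 0" and mono: "monotone_on (small ?S \<delta>) (\<le>) (\<le>) r"
    and free: "\<And>e. e \<in> small ?S \<delta> \<Longrightarrow> r (uminus ` e) \<noteq> r e"
    and le: "\<And>e. e \<in> small ?S \<delta> \<Longrightarrow> \<exists>u\<in>?S. r e \<le> \<rho> (point_sample \<F> u)"
    and "finite (r ` small ?S \<delta>)"
    using small_set_map[OF assms] by blast
  define R where "R e = Rep_H2inf (r e)" for e
  have R2: "2 \<le> \<bar>R e\<bar>" for e
    using Rep_H2inf[of "r e"] by (simp add: R_def)
  have Rn: "\<bar>R e\<bar> < int n + 2" if e: "e \<in> small ?S \<delta>" for e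
  proof -
    obtain u where u: "u \<in> ?S" "r e \<le> \<rho> (point_sample \<F> u)" using le[OF e] by blast
    have "enat (nat (\<bar>R e\<bar> - 2)) \<le> poset_rank (r e)"
      unfolding R_def by (rule poset_rank_H2inf_ge)
    also have "\<dots> \<le> poset_rank (\<rho> (point_sample \<F> u))"
      using u(2) by (rule poset_rank_mono)
    also have "\<dots> < enat n"
      using u(1) by (rule low)
    finally show ?thesis by simp
  qed
  have R_mono: "R e = R e' \<or> \<bar>R e\<bar> < \<bar>R e'\<bar>"
    if "e \<in> small ?S \<delta>" "e' \<in> small ?S \<delta>" "e \<subseteq> e'" for e e'
  proof -
    have "r e \<le> r e'" using mono that by (rule monotone_onD)
    then show ?thesis by (auto simp: less_eq_H2inf_def R_def)
  qed
  have R_free: "R e \<noteq> R (uminus ` e)" if "e \<in> small ?S \<delta>" for e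
    using free[OF that] by (auto simp: R_def Rep_H2inf_inject)
  \<comment> \<open>Freeness makes ties harmless in the same way, so \<open>L\<close> is odd under
    the antipode.\<close>
  define L where "L e = (if \<bar>R e\<bar> \<le> \<bar>R (uminus ` e)\<bar> then R e else - R (uminus ` e))" for e
  define l where "l e = Abs_H2inf (L e)" for e
  have Rep_l: "Rep_H2inf (l e) = L e" for e
    unfolding l_def by (rule Abs_H2inf_inverse) (use R2 in \<open>simp add: L_def\<close>)
  have L_neg: "L (uminus ` e) = - L e" if "e \<in> small ?S \<delta>" for e
    using R_free[OF that] by (auto simp: L_def image_image)
  have l_mono: "monotone_on (small ?S \<delta>) (\<le>) (\<le>) l"
  proof (rule monotone_onI)
    fix e e' assume e: "e \<in> small ?S \<delta>" "e' \<in> small ?S \<delta>" "e \<subseteq> e'"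
    have "uminus ` e \<in> small ?S \<delta>" "uminus ` e' \<in> small ?S \<delta>" "uminus ` e \<subseteq> uminus ` e'"
      using uminus_image_small[OF e(1)] uminus_image_small[OF e(2)] e(3) by blast+
    then have "L e = L e' \<or> \<bar>L e\<bar> < \<bar>L e'\<bar>"
      unfolding L_def
      using R_mono[OF e] R_mono[of "uminus ` e" "uminus ` e'"] R_free[OF e(1)] R_free[OF e(2)]
      by (intro abs_min_mono)
    then show "l e \<le> l e'"
      unfolding less_eq_H2inf_def Rep_l by (auto simp: l_def)
  qed
  define B where "B = {p. \<bar>Rep_H2inf p\<bar> < int n + 2}"
  have ranked: "ranked B (\<lambda>p. nat (\<bar>Rep_H2inf p\<bar> - 2)) (n - 1)"
  proof
    show "nat (\<bar>Rep_H2inf x\<bar> - 2) < nat (\<bar>Rep_H2inf y\<bar> - 2)" if "x < y" for x y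
      using that Rep_H2inf[of x] by (simp add: less_H2inf_def)
  qed (auto simp: B_def)
  have l_B: "l e \<in> B" if "e \<in> small ?S \<delta>" for e
    using Rn[OF that] Rn[OF uminus_image_small[OF that]] by (simp add: B_def Rep_l L_def)
  define h where "h p \<longleftrightarrow> Rep_H2inf p > 0" for p
  show False
  proof (rule alternating_not_coboundary[where h = "h \<circ> l"])
    show "n < DIM('a)" using assms(1) by (simp add: sphere_cover_def)
    show "\<delta> > 0" by fact
    show "(h \<circ> l) (uminus ` e) \<longleftrightarrow> \<not> (h \<circ> l) e" if "e \<in> small ?S \<delta>" for e
    proof -
      have "2 \<le> \<bar>L e\<bar>" using R2 by (simp add: L_def)
      then show ?thesis using L_neg[OF that] by (auto simp: h_def Rep_l)
    qed
    fix xs assume xs: "xs \<in> multichains (small ?S \<delta>) (Suc n)"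
    have m: "map l xs \<in> multichains B (Suc n)"
      using xs l_B l_mono by (rule multichains_map)
    \<comment> \<open>An alternating image would be a strict chain of \<open>n + 1\<close> elements
      in \<open>n\<close> levels. So the cochain is 0, trivially a coboundary.\<close>
    have "\<not> alternating h True (map l xs)"
    proof
      assume "alternating h True (map l xs)"
      then have "sorted_wrt (<) (map l xs)"
        using m by (intro alternating_strict) (auto simp: multichains_def)
      then have "length (map l xs) \<le> Suc (n - 1)"
        using m by (intro ranked.length_strict_chain[OF ranked]) (auto simp: multichains_def)
      \<comment> \<open>For \<open>n = 0\<close> the truncated \<open>n - 1\<close> would still
        allow one level, but then \<open>B\<close> is empty.\<close>
      moreover have "n \<noteq> 0"
      proof
        assume "n = 0"
        moreover have "2 \<le> \<bar>Rep_H2inf p\<bar>" for p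
          using Rep_H2inf[of p] by simp
        ultimately have "B = {}" by (force simp: B_def not_less)
        then show False using m by (auto simp: multichains_def)
      qed
      ultimately show False using m by (auto simp: multichains_def)
    qed
    then show "of_bool (alternating (h \<circ> l) True xs) = cobd (\<lambda>_. 0) xs"
      by (simp flip: alternating_map)
  qed
qed

text \<open>For \<open>n = 0\<close> the first bound can fail: the two points of the sphere may go
  to two incomparable elements of rank 0.\<close>

theorem lemma1:
  fixes n :: nat and \<F> :: "'a::euclidean_space set set"
  assumes "sphere_cover n \<F>"
  shows "(n \<ge> 1 \<longrightarrow>
           (\<forall>\<rho> :: 'a sample \<Rightarrow> 'p::order.
              monotone_on (H_int \<F>) (\<subseteq>\<^sub>m) (\<le>) \<rho> \<and>
              (\<forall>s\<in>H_int \<F>. \<rho> s \<noteq> \<rho> (antipode s)) \<longrightarrow>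
              (\<exists>u\<in>sphere 0 1.
                 ereal_of_enat (poset_rank (\<rho> (point_sample \<F> u))) \<ge> ereal ((real n + 1) / 2)))) \<and>
         (\<forall>\<rho> :: 'a sample \<Rightarrow> H2inf.
            monotone_on (H_int \<F>) (\<subseteq>\<^sub>m) (\<le>) \<rho> \<and>
            (\<forall>s\<in>H_int \<F>. \<rho> s \<noteq> \<rho> (antipode s)) \<longrightarrow>
            (\<exists>u\<in>sphere 0 1. poset_rank (\<rho> (point_sample \<F> u)) \<ge> enat n))"
proof -
  \<comment> \<open>An integer above \<open>n div 2\<close> is at least \<open>(n + 1) / 2\<close>,
    for either parity; infinity is covered too.\<close>
  have "ereal_of_enat k \<ge> ereal ((real n + 1) / 2)" if "\<not> k \<le> enat (n div 2)" for k
    using that by (cases k) auto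
  then show ?thesis
    using rank_lower_bound[OF assms] rank_H2inf_lower_bound[OF assms] by blast
qed

end
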